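(* Let $(X,T)$ be a topological dynamical system. Then the following conditions are equivalent: (1) $(X,T)$ is a weakly mixing E-system. (2) $Trans_{\mathcal F_{D}}(X,T)$ is residual in $X$. (3) $(X,T)$ is $\mathcal F_{D}$-point transitive.
   Context: A topological dynamical system (TDS) is a pair $(X,T)$ with $X$ a nonempty compact metric space and $T:X\to X$ continuous. "Opene" means nonempty open. For opene $U,V\subset X$ and $x\in X$: $N(U,V)=\{n\in\mathbb Z_+: U\cap T^{-n}V\ne\emptyset\}$, $N(x,U)=\{n\in\mathbb Z_+: T^nx\in U\}$ (the latter also for neighborhoods $U$, and likewise for product systems). $Orb(x,T)=\{x,Tx,T^2x,\dots\}$. $(X,T)$ is transitive if $N(U,V)$ is infinite for all opene $U,V$; weakly mixing if $(X\times X,T\times T)$ is transitive; an E-system if it is transitive and has a $T$-invariant Borel probability measure with full support. The upper Banach density of $F\subset\mathbb Z_+$ is $BD^*(F)=\limsup_{|I|\to\infty}|F\cap I|/|I|$, with $I$ ranging over nonempty finite intervals of $\mathbb Z_+$; $\mathcal F_{pubd}$ is the family of sets with positive upper Banach density. A point $y$ is $\mathcal F_{pubd}$-recurrent if $N(y,U)\in\mathcal F_{pubd}$ for every neighborhood $U$ of $y$. A set $F\subset\mathbb Z_+$ is a D-set if there exist a TDS $(Y,S)$, a point $x\in Y$, an $\mathcal F_{pubd}$-recurrent point $y\in Y$ and a neighborhood $U$ of $y$ such that $(y,y)\in\overline{Orb((x,y),S\times S)}$ and $N((x,y),U\times U)\subset F$. $\mathcal F_D$ is the family of all D-sets. For a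 family $\mathcal F$ of subsets of $\mathbb Z_+$, $x\in X$ is an $\mathcal F$-transitive point if $N(x,U)\in\mathcal F$ for every opene $U$; the set of these is $Trans_{\mathcal F}(X,T)$, and $(X,T)$ is $\mathcal F$-point transitive if this set is nonempty. A set is residual if it contains a dense $G_\delta$ subset. *)

theory Defs
  imports "HOL-Probability.Probability"
begin

text \<open>
  Metric spaces are elements of the library type \<open>'a metric\<close> (carrier together with distance),
  so that one can quantify over them. A self-map \<open>T\<close> is a total HOL function of which only the
  restriction to the carrier matters.
\<close>

definition TDS :: "'a metric \<Rightarrow> ('a \<Rightarrow> 'a) \<Rightarrow> bool" where
  "TDS X T \<longleftrightarrow> mspace X \<noteq> {} \<and> compact_space (mtopology_of X) \<and>
     continuous_map (mtopology_of X) (mtopology_of X) T"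

definition opene :: "'a metric \<Rightarrow> 'a set \<Rightarrow> bool" where
  "opene X U \<longleftrightarrow> openin (mtopology_of X) U \<and> U \<noteq> {}"

text \<open>Neighborhoods are not required to be open.\<close>

definition neighborhood :: "'a metric \<Rightarrow> 'a \<Rightarrow> 'a set \<Rightarrow> bool" where
  "neighborhood X x U \<longleftrightarrow>
     U \<subseteq> mspace X \<and> (\<exists>V. openin (mtopology_of X) V \<and> x \<in> V \<and> V \<subseteq> U)"

text \<open>The sets \<open>N(U,V)\<close> and \<open>N(x,U)\<close>.\<close>

definition hitting_times :: "('a \<Rightarrow> 'a) \<Rightarrow> 'a set \<Rightarrow> 'a set \<Rightarrow> nat set" where
  "hitting_times T U V = {n. U \<inter> (T ^^ n) -` V \<noteq> {}}"

definition visit_times :: "('a \<Rightarrow> 'a) \<Rightarrow> 'a \<Rightarrow> 'a set \<Rightarrow> nat set" where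
  "visit_times T x U = {n. (T ^^ n) x \<in> U}"

definition orb :: "('a \<Rightarrow> 'a) \<Rightarrow> 'a \<Rightarrow> 'a set" where
  "orb T x = range (\<lambda>n. (T ^^ n) x)"

definition transitive :: "'a metric \<Rightarrow> ('a \<Rightarrow> 'a) \<Rightarrow> bool" where
  "transitive X T \<longleftrightarrow> (\<forall>U V. opene X U \<longrightarrow> opene X V \<longrightarrow> infinite (hitting_times T U V))"

definition weakly_mixing :: "'a metric \<Rightarrow> ('a \<Rightarrow> 'a) \<Rightarrow> bool" where
  "weakly_mixing X T \<longleftrightarrow> transitive (prod_metric X X) (map_prod T T)"

definition borel_prob_on :: "'a metric \<Rightarrow> 'a measure \<Rightarrow> bool" where
  "borel_prob_on X \<mu> \<longleftrightarrow> space \<mu> = mspace X \<and>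
     sets \<mu> = sigma_sets (mspace X) {U. openin (mtopology_of X) U} \<and> prob_space \<mu>"

definition invariant_under :: "('a \<Rightarrow> 'a) \<Rightarrow> 'a measure \<Rightarrow> bool" where
  "invariant_under T \<mu> \<longleftrightarrow> (\<forall>A \<in> sets \<mu>. emeasure \<mu> (T -` A \<inter> space \<mu>) = emeasure \<mu> A)"

definition measure_support :: "'a metric \<Rightarrow> 'a measure \<Rightarrow> 'a set" where
  "measure_support X \<mu> =
     {x \<in> mspace X. \<forall>U. openin (mtopology_of X) U \<and> x \<in> U \<longrightarrow> emeasure \<mu> U > 0}"

definition E_system :: "'a metric \<Rightarrow> ('a \<Rightarrow> 'a) \<Rightarrow> bool" where
  "E_system X T \<longleftrightarrow> transitive X T \<and>
     (\<exists>\<mu>. borel_prob_on X \<mu> \<and> invariant_under T \<mu> \<and> measure_support X \<mu> = mspace X)"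

definition nat_intervals :: "nat set set" where
  "nat_intervals = {{m..n} |m n. m \<le> n}"

text \<open>The filter below expresses ``\<open>|I| \<rightarrow> \<infinity>\<close> with \<open>I\<close> ranging over the nonempty finite intervals''.\<close>

definition upper_Banach_density :: "nat set \<Rightarrow> ereal" where
  "upper_Banach_density F =
     Limsup (inf (filtercomap card at_top) (principal nat_intervals))
       (\<lambda>I. ereal (real (card (F \<inter> I)) / real (card I)))"

definition F_pubd :: "nat set set" where
  "F_pubd = {F. upper_Banach_density F > 0}"

definition recurrent_point :: "nat set set \<Rightarrow> 'a metric \<Rightarrow> ('a \<Rightarrow> 'a) \<Rightarrow> 'a \<Rightarrow> bool" where
  "recurrent_point \<F> X T y \<longleftrightarrow> y \<in> mspace X \<and> (\<forall>U. neighborhood X y U \<longrightarrow> visit_times T y U \<in> \<F>)"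

definition D_set_from :: "'a metric \<Rightarrow> ('a \<Rightarrow> 'a) \<Rightarrow> nat set \<Rightarrow> bool" where
  "D_set_from Y S F \<longleftrightarrow> TDS Y S \<and>
     (\<exists>x y U. x \<in> mspace Y \<and> recurrent_point F_pubd Y S y \<and> neighborhood Y y U \<and>
        (y, y) \<in> mtopology_of (prod_metric Y Y) closure_of orb (map_prod S S) (x, y) \<and>
        visit_times (map_prod S S) (x, y) (U \<times> U) \<subseteq> F)"

text \<open>
  HOL cannot quantify over types inside a formula, so the witnessing system is taken with an
  arbitrary metric on an arbitrary set of real numbers, the usual topology of the reals playing
  no role. Since a compact metric space has at most the cardinality of the continuum, this
  is no restriction: lemma \<open>D_set_from_imp_F_D\<close> below shows that systems over any type yield
  members of \<open>F_D\<close>.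
\<close>

definition F_D :: "nat set set" where
  "F_D = {F. \<exists>(Y :: real metric) S. D_set_from Y S F}"

definition Trans :: "nat set set \<Rightarrow> 'a metric \<Rightarrow> ('a \<Rightarrow> 'a) \<Rightarrow> 'a set" where
  "Trans \<F> X T = {x \<in> mspace X. \<forall>U. opene X U \<longrightarrow> visit_times T x U \<in> \<F>}"

definition point_transitive :: "nat set set \<Rightarrow> 'a metric \<Rightarrow> ('a \<Rightarrow> 'a) \<Rightarrow> bool" where
  "point_transitive \<F> X T \<longleftrightarrow> Trans \<F> X T \<noteq> {}"

definition residual_in :: "'a metric \<Rightarrow> 'a set \<Rightarrow> bool" where
  "residual_in X R \<longleftrightarrow>
     (\<exists>G \<subseteq> R. gdelta_in (mtopology_of X) G \<and> mtopology_of X closure_of G = mspace X)"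

lemma compact_metric_lepoll_reals:
  fixes Y :: "'b metric"
  assumes "compact_space (mtopology_of Y)"
  shows "mspace Y \<lesssim> (UNIV :: real set)"
proof -
  interpret Y: Metric_space "mspace Y" "mdist Y" by simp
  have tb: "Y.mtotally_bounded (mspace Y)"
    using assms Y.compactin_imp_mtotally_bounded
    by (metis compact_space_def mtopology_of_def topspace_mtopology_of)
  have "\<exists>K. finite K \<and> K \<subseteq> mspace Y \<and> mspace Y \<subseteq> (\<Union>x\<in>K. Y.mball x (inverse (Suc n)))" for n
    using tb unfolding Y.mtotally_bounded_def by simp
  then obtain K where K: "\<And>n. finite (K n)" "\<And>n. K n \<subseteq> mspace Y"
      "\<And>n. mspace Y \<subseteq> (\<Union>x\<in>K n. Y.mball x (inverse (Suc n)))"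
    by metis
  define C where "C = (SIGMA n:(UNIV::nat set). K n)"
  have cC: "countable C"
    unfolding C_def by (intro countable_SIGMA) (auto simp: K countable_finite)
  define h where "h x = to_nat_on C ` {(n, c) \<in> C. mdist Y c x < inverse (Suc n)}" for x
  have "inj_on h (mspace Y)"
  proof (rule inj_onI, rule ccontr)
    fix x z assume xz: "x \<in> mspace Y" "z \<in> mspace Y" "h x = h z" "x \<noteq> z"
    then have "0 < mdist Y x z / 2" by simp
    then obtain n where n: "inverse (real (Suc n)) < mdist Y x z / 2"
      using reals_Archimedean by blast
    obtain c where c: "c \<in> K n" "mdist Y c x < inverse (Suc n)"
      using K(3)[of n] xz by auto
    then have nc: "(n, c) \<in> C" and "to_nat_on C (n, c) \<in> h x"
      by (auto simp: C_def h_def)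
    then have "to_nat_on C (n, c) \<in> h z" using xz by simp
    then obtain p where p: "p \<in> C" "to_nat_on C p = to_nat_on C (n, c)"
        "mdist Y (snd p) z < inverse (Suc (fst p))"
      by (force simp: h_def)
    then have "p = (n, c)"
      using inj_on_to_nat_on[OF cC] nc by (auto dest: inj_onD)
    with p have "mdist Y c z < inverse (Suc n)" by simp
    moreover have "mdist Y x z \<le> mdist Y c x + mdist Y c z"
      using mdist_triangle[of x Y c z] K(2) c xz by (metis mdist_commute subsetD)
    ultimately show False using c n by linarith
  qed
  then have "mspace Y \<lesssim> (UNIV :: nat set set)"
    unfolding lepoll_def by blast
  then show ?thesis
    using eqpoll_imp_lepoll lepoll_trans nat_sets_eqpoll_reals by blast
qed

lemma funpow_map_prod:
  fixes f :: "'a \<Rightarrow> 'a" and g :: "'b \<Rightarrow> 'b"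
  shows "(map_prod f g ^^ n) (x, y) = ((f ^^ n) x, (g ^^ n) y)"
  by (induction n) auto

lemma F_pubd_mono:
  assumes "F \<in> F_pubd" "F \<subseteq> G"
  shows "G \<in> F_pubd"
proof -
  have "upper_Banach_density F \<le> upper_Banach_density G"
    unfolding upper_Banach_density_def
    by (rule Limsup_mono, unfold eventually_inf_principal)
       (use assms in \<open>auto simp: nat_intervals_def intro!: always_eventually divide_right_mono card_mono\<close>)
  then show ?thesis using assms by (auto simp: F_pubd_def)
qed

lemma D_set_from_imp_F_D:
  fixes Y :: "'b metric"
  assumes "D_set_from Y S F"
  shows "F \<in> F_D"
proof -
  have Y: "mspace Y \<noteq> {}" "compact_space (mtopology_of Y)"
    and contS: "continuous_map (mtopology_of Y) (mtopology_of Y) S"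
    using assms by (auto simp: D_set_from_def TDS_def)
  have SY: "(S ^^ n) u \<in> mspace Y" if "u \<in> mspace Y" for u n
    using that contS by (induction n) (auto simp: continuous_map_def)
  obtain x y U where xy: "x \<in> mspace Y" "recurrent_point F_pubd Y S y"
    and U: "neighborhood Y y U"
    and cl: "(y, y) \<in> mtopology_of (prod_metric Y Y) closure_of orb (map_prod S S) (x, y)"
    and sub: "visit_times (map_prod S S) (x, y) (U \<times> U) \<subseteq> F"
    using assms by (auto simp: D_set_from_def)
  have y: "y \<in> mspace Y" using xy by (simp add: recurrent_point_def)
  obtain f :: "'b \<Rightarrow> real" where inj: "inj_on f (mspace Y)"
    using compact_metric_lepoll_reals[OF Y(2)] by (auto simp: lepoll_def)
  define g where "g = inv_into (mspace Y) f"
  have gf: "g (f u) = u" if "u \<in> mspace Y" for u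
    using that inj by (simp add: g_def)
  define d where "d = (\<lambda>a b. mdist Y (g a) (g b))"
  interpret Z: Metric_space "f ` mspace Y" d
    by unfold_locales (auto simp: d_def gf mdist_commute mdist_triangle)
  interpret YZ: Metric_space12 "mspace Y" "mdist Y" "f ` mspace Y" d
    by (simp add: Metric_space12_def Z.Metric_space_axioms)
  define Z where "Z = metric (f ` mspace Y, d)"
  have Z [simp]: "mspace Z = f ` mspace Y"
    by (simp add: Z_def)
  have mZ: "mtopology_of Z = Z.mtopology"
    by (simp add: Z_def)
  have "homeomorphic_map (mtopology_of Y) (mtopology_of Z) f"
    unfolding mZ unfolding mtopology_of_def
    by (rule YZ.isometry_imp_homeomorphic_map) (auto simp: d_def gf)
  then obtain g' where "homeomorphic_maps (mtopology_of Y) (mtopology_of Z) f g'"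
    using homeomorphic_map_maps by blast
  then have contf: "continuous_map (mtopology_of Y) (mtopology_of Z) f"
    and contg': "continuous_map (mtopology_of Z) (mtopology_of Y) g'"
    and g'f: "\<And>u. u \<in> mspace Y \<Longrightarrow> g' (f u) = u"
    by (auto simp: homeomorphic_maps_def)
  define R where "R = f \<circ> S \<circ> g'"
  have contR: "continuous_map (mtopology_of Z) (mtopology_of Z) R"
    unfolding R_def
    by (rule continuous_map_compose[OF contg' continuous_map_compose[OF contS contf]])
  have Rf: "(R ^^ n) (f u) = f ((S ^^ n) u)" if "u \<in> mspace Y" for u n
    using that by (induction n) (auto simp: R_def g'f SY)
  have compZ: "compact_space (mtopology_of Z)"
    using image_compactin[OF _ contf, of "mspace Y"] Y unfolding compact_space_def by simp
  have tds: "TDS Z R"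
    using Y contR compZ by (simp add: TDS_def)
  have pre: "neighborhood Y u {v \<in> mspace Y. f v \<in> V}"
    if nV: "neighborhood Z (f u) V" and uY: "u \<in> mspace Y" for u V
  proof -
    obtain W where W: "openin (mtopology_of Z) W" "f u \<in> W" "W \<subseteq> V"
      using nV unfolding neighborhood_def by blast
    have "openin (mtopology_of Y) {v \<in> topspace (mtopology_of Y). f v \<in> W}"
      using contf W openin_continuous_map_preimage by blast
    then have "openin (mtopology_of Y) {v \<in> mspace Y. f v \<in> W}"
      by simp
    moreover have "u \<in> {v \<in> mspace Y. f v \<in> W}" "{v \<in> mspace Y. f v \<in> W} \<subseteq> {v \<in> mspace Y. f v \<in> V}"
      using uY W by blast+
    ultimately show ?thesis
      unfolding neighborhood_def by blast
  qed
  have rec: "recurrent_point F_pubd Z R (f y)"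
    unfolding recurrent_point_def
  proof (intro conjI allI impI)
    show "f y \<in> mspace Z" using y by simp
    fix V assume V: "neighborhood Z (f y) V"
    have "visit_times S y {v \<in> mspace Y. f v \<in> V} \<in> F_pubd"
      using xy(2) pre[OF V y] by (auto simp: recurrent_point_def)
    moreover have "visit_times S y {v \<in> mspace Y. f v \<in> V} \<subseteq> visit_times R (f y) V"
      by (auto simp: visit_times_def Rf y)
    ultimately show "visit_times R (f y) V \<in> F_pubd"
      by (rule F_pubd_mono)
  qed
  have nbh: "neighborhood Z (f y) (f ` U)"
  proof -
    obtain W where W: "openin (mtopology_of Y) W" "y \<in> W" "W \<subseteq> U" and UY: "U \<subseteq> mspace Y"
      using U unfolding neighborhood_def by blast
    have "openin (mtopology_of Z) {v \<in> topspace (mtopology_of Z). g' v \<in> W}"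
      using contg' W openin_continuous_map_preimage by blast
    then have "openin (mtopology_of Z) {v \<in> mspace Z. g' v \<in> W}"
      by (simp only: topspace_mtopology_of)
    moreover have "f y \<in> {v \<in> mspace Z. g' v \<in> W}"
      using y W g'f[OF y] by simp
    moreover have "{v \<in> mspace Z. g' v \<in> W} \<subseteq> f ` U"
    proof
      fix v assume "v \<in> {v \<in> mspace Z. g' v \<in> W}"
      then obtain u where u: "u \<in> mspace Y" "v = f u" "g' v \<in> W" by auto
      then have "u \<in> U" using g'f[OF u(1)] W(3) by auto
      then show "v \<in> f ` U" using u by blast
    qed
    moreover have "f ` U \<subseteq> mspace Z" using UY by auto
    ultimately show ?thesis
      unfolding neighborhood_def by blast
  qed
  have clZ: "(f y, f y) \<in> mtopology_of (prod_metric Z Z) closure_of orb (map_prod R R) (f x, f y)"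
    unfolding in_closure_of
  proof (intro conjI allI impI)
    show "(f y, f y) \<in> topspace (mtopology_of (prod_metric Z Z))"
      using y by simp
    fix A assume A: "(f y, f y) \<in> A \<and> openin (mtopology_of (prod_metric Z Z)) A"
    define B where "B = {p \<in> topspace (mtopology_of (prod_metric Y Y)). (\<lambda>(u, v). (f u, f v)) p \<in> A}"
    have "continuous_map (mtopology_of (prod_metric Y Y)) (mtopology_of (prod_metric Z Z))
        (\<lambda>(u, v). (f u, f v))"
      unfolding mtopology_of_prod_metric continuous_map_prod_top using contf by simp
    then have "openin (mtopology_of (prod_metric Y Y)) B"
      unfolding B_def using A openin_continuous_map_preimage by blast
    moreover have "(y, y) \<in> B" using y A by (simp add: B_def)
    ultimately obtain p where p: "p \<in> orb (map_prod S S) (x, y)" "p \<in> B"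
      using cl[unfolded in_closure_of, THEN conjunct2, rule_format, of B] by auto
    then obtain n where "p = ((S ^^ n) x, (S ^^ n) y)"
      by (auto simp: orb_def funpow_map_prod)
    then have "((R ^^ n) (f x), (R ^^ n) (f y)) \<in> A"
      using p xy y by (simp add: B_def Rf)
    moreover have "((R ^^ n) (f x), (R ^^ n) (f y)) \<in> orb (map_prod R R) (f x, f y)"
      unfolding orb_def funpow_map_prod by (rule rangeI)
    ultimately show "\<exists>q. q \<in> orb (map_prod R R) (f x, f y) \<and> q \<in> A"
      by blast
  qed
  have "U \<subseteq> mspace Y" using U by (simp add: neighborhood_def)
  then have "visit_times (map_prod R R) (f x, f y) (f ` U \<times> f ` U) \<subseteq> F"
    using sub xy y SY inj
    by (auto simp: visit_times_def funpow_map_prod Rf inj_on_image_mem_iff)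
  then have "D_set_from Z R F"
    unfolding D_set_from_def using tds rec nbh clZ xy(1)
    by (intro conjI exI[of _ "f x"] exI[of _ "f y"] exI[of _ "f ` U"]) simp_all
  then show ?thesis by (auto simp: F_D_def)
qed

end

theory Submission
  imports Defs
begin

text \<open>
  For (1) \<open>\<Longrightarrow>\<close> (2), Baire category and weak mixing give a point \<open>y\<close> such that, for a residual set of \<open>x\<close>,
  the pair \<open>(x, y)\<close> has a dense orbit in \<open>X \<times> X\<close>. A full-support invariant measure makes every point with
  dense orbit return to open sets with positive upper Banach density: averaging an indicator gives some \<open>z\<close> whose
  orbit segment visits \<open>U\<close> often enough, and the orbit of \<open>y\<close> shadows that segment. So the iterates of \<open>y\<close> that
  lie in \<open>U\<close> witness that \<open>N(x, U)\<close> is a D-set.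

  For (3) \<open>\<Longrightarrow>\<close> (1), a D-set has positive upper Banach density and contains all differences \<open>s j - s i\<close>
  (\<open>i < j\<close>) of arbitrarily long finite sequences, hence meets \<open>G - G\<close> whenever \<open>G\<close> has positive upper Banach
  density. Applied to \<open>N(x, T\<^sup>-\<^sup>t V)\<close> with \<open>T\<^sup>t x \<in> U\<close> and \<open>G = N(x, U)\<close>, this shows that \<open>N(U, U)\<close> and
  \<open>N(U, V)\<close> intersect, which implies weak mixing. The measure arises from a shift-invariant finitely additive
  probability \<open>m\<close> on \<open>\<nat>\<close> that is positive on \<open>N(x, B)\<close> for all \<open>B\<close> of a countable \<open>\<pi>\<close>-base: the content
  \<open>A \<mapsto> m (N(x, A))\<close> is made inner regular on open sets and extended by Caratheodory's theorem.
\<close>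

section \<open>From finitely additive contents to Borel measures\<close>

text \<open>Every set gets a value, because \<open>m\<close> of the visit times of a point makes
  sense for arbitrary sets. What may fail for \<open>\<nu>\<close> is countable additivity;
  compactness and normality recover it after regularization.\<close>

locale finitely_additive_content =
  fixes X :: "'a topology" and \<nu> :: "'a set \<Rightarrow> ennreal"
  assumes compact: "compact_space X" and normal: "normal_space X"
    and empty: "\<nu> {} = 0"
    and additive: "A \<inter> B = {} \<Longrightarrow> \<nu> (A \<union> B) = \<nu> A + \<nu> B"
begin

lemma mono: "A \<subseteq> B \<Longrightarrow> \<nu> A \<le> \<nu> B"
  using additive[of A "B - A"] by (simp add: Un_absorb1 Diff_partition)

lemma subadditive: "\<nu> (A \<union> B) \<le> \<nu> A + \<nu> B"
  using additive[of A "B - A"] mono[of "B - A" B]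
  by (metis Diff_disjoint Diff_subset Un_Diff_cancel add_left_mono)

text \<open>Approximation from inside by closed sets is what lets compactness act: a countable open
  cover of a closed set can be made finite. The values of \<open>\<nu>\<close> on open sets
  themselves may be lost here.\<close>

definition inner_content :: "'a set \<Rightarrow> ennreal" where
  "inner_content G = (SUP K\<in>{K. closedin X K \<and> K \<subseteq> G}. \<nu> K)"

definition outer :: "'a set \<Rightarrow> ennreal" where
  "outer A = (INF G\<in>{G. openin X G \<and> A \<subseteq> G}. inner_content G)"

lemma inner_content_upper: "closedin X K \<Longrightarrow> K \<subseteq> G \<Longrightarrow> \<nu> K \<le> inner_content G"
  unfolding inner_content_def by (rule SUP_upper) simp

lemma inner_content_mono: "G \<subseteq> H \<Longrightarrow> inner_content G \<le> inner_content H"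
  unfolding inner_content_def by (rule SUP_subset_mono) auto

lemma inner_content_empty: "inner_content {} = 0"
  by (simp add: inner_content_def empty cong: conj_cong)

text \<open>A closed K inside G \<union> H has to be cut into closed pieces inside G and H.
  Normality, in its dual form, shrinks the open cover of the space by G \<union> (complement of K)
  and H to a closed cover S, T, and the pieces are K \<inter> S and K \<inter> T.\<close>

lemma inner_content_Un:
  assumes "openin X G" "openin X H"
  shows "inner_content (G \<union> H) \<le> inner_content G + inner_content H"
  unfolding inner_content_def[of "G \<union> H"]
proof (rule SUP_least)
  fix K assume "K \<in> {K. closedin X K \<and> K \<subseteq> G \<union> H}"
  then have K: "closedin X K" "K \<subseteq> G \<union> H" by auto
  have "openin X (G \<union> (topspace X - K))"
    using K assms by (simp add: openin_Un openin_diff)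
  moreover have "G \<union> (topspace X - K) \<union> H = topspace X"
    using assms K openin_subset by fastforce
  ultimately obtain S T where ST: "closedin X S" "closedin X T" "S \<subseteq> G \<union> (topspace X - K)" "T \<subseteq> H"
      "S \<union> T = topspace X"
    using normal assms(2) unfolding normal_space_dual by meson
  have "K \<subseteq> S \<union> T"
    unfolding ST(5) using K(1) by (rule closedin_subset)
  then have "K = (K \<inter> S) \<union> (K \<inter> T)"
    by blast
  then have "\<nu> K \<le> \<nu> (K \<inter> S) + \<nu> (K \<inter> T)"
    by (metis subadditive)
  also have "\<dots> \<le> inner_content G + inner_content H"
    using K ST by (intro add_mono inner_content_upper closedin_Int) auto
  finally show "\<nu> K \<le> inner_content G + inner_content H" .
qed

lemma inner_content_UN_finite:
  fixes G :: "nat \<Rightarrow> 'a set"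
  assumes "\<And>i. openin X (G i)"
  shows "inner_content (\<Union>i<n. G i) \<le> (\<Sum>i<n. inner_content (G i))"
proof (induction n)
  case 0
  then show ?case by (simp add: inner_content_empty)
next
  case (Suc n)
  have "inner_content ((\<Union>i<n. G i) \<union> G n) \<le> inner_content (\<Union>i<n. G i) + inner_content (G n)"
    using assms by (intro inner_content_Un) auto
  also have "\<dots> \<le> (\<Sum>i<n. inner_content (G i)) + inner_content (G n)"
    using Suc by (intro add_right_mono)
  finally show ?case by (simp add: lessThan_Suc Un_commute add.commute)
qed

text \<open>Each closed K in the union is compact, so finitely many of the open sets cover it, and
  the finite case applies.\<close>

lemma inner_content_UN:
  fixes G :: "nat \<Rightarrow> 'a set"
  assumes "\<And>i. openin X (G i)"
  shows "inner_content (\<Union>i. G i) \<le> (\<Sum>i. inner_content (G i))"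
  unfolding inner_content_def[of "\<Union>i. G i"]
proof (rule SUP_least)
  fix K assume "K \<in> {K. closedin X K \<and> K \<subseteq> (\<Union>i. G i)}"
  then have K: "closedin X K" "K \<subseteq> (\<Union>i. G i)" by auto
  then have "compactin X K"
    using compact closedin_compact_space by blast
  then have "\<exists>\<F>. finite \<F> \<and> \<F> \<subseteq> range G \<and> K \<subseteq> \<Union>\<F>"
    using assms K unfolding compactin_def by (metis (no_types, lifting) imageE)
  then obtain \<F> where F: "finite \<F>" "\<F> \<subseteq> range G" "K \<subseteq> \<Union>\<F>"
    by blast
  obtain I where I: "finite I" "\<F> = G ` I"
    using finite_subset_image[OF F(1,2)] by blast
  obtain n where n: "I \<subseteq> {..<n}"
    using I(1) finite_nat_iff_bounded by blast
  have "K \<subseteq> (\<Union>i<n. G i)"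
    using F(3) I(2) n by blast
  then have "\<nu> K \<le> inner_content (\<Union>i<n. G i)"
    using K(1) inner_content_upper by blast
  also have "\<dots> \<le> (\<Sum>i<n. inner_content (G i))"
    by (rule inner_content_UN_finite[OF assms])
  also have "\<dots> \<le> (\<Sum>i. inner_content (G i))"
    by (rule sum_le_suminf) auto
  finally show "\<nu> K \<le> (\<Sum>i. inner_content (G i))" .
qed

section \<open>Outer measure and Caratheodory extension\<close>

lemma outer_open: "openin X G \<Longrightarrow> outer G = inner_content G"
  unfolding outer_def
  by (rule antisym) (auto intro!: INF_lower INF_greatest inner_content_mono)

lemma outer_mono: "A \<subseteq> B \<Longrightarrow> outer A \<le> outer B"
  unfolding outer_def by (rule INF_superset_mono) auto

lemma outer_approx:
  assumes "A \<subseteq> topspace X" "0 < e"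
  shows "\<exists>G. openin X G \<and> A \<subseteq> G \<and> inner_content G \<le> outer A + ennreal e"
proof (cases "outer A = top")
  case True
  then show ?thesis
    using assms by (intro exI[of _ "topspace X"]) auto
next
  case False
  then have "outer A < outer A + ennreal e"
    using assms(2) by (cases "outer A") (auto simp: ennreal_plus[symmetric] ennreal_less_iff simp del: ennreal_plus)
  then obtain G where "openin X G" "A \<subseteq> G" "inner_content G < outer A + ennreal e"
    unfolding outer_def[of A] INF_less_iff by auto
  then show ?thesis
    by (auto intro: less_imp_le)
qed

lemma outer_UN:
  fixes A :: "nat \<Rightarrow> 'a set"
  assumes "\<And>i. A i \<subseteq> topspace X"
  shows "outer (\<Union>i. A i) \<le> (\<Sum>i. outer (A i))"
proof (rule ennreal_le_epsilon)
  fix e :: real assume "0 < e"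
  define d where "d i = e * (1/2) ^ Suc i" for i
  have d: "0 < d i" for i
    using \<open>0 < e\<close> by (simp add: d_def)
  have "\<exists>G. openin X G \<and> A i \<subseteq> G \<and> inner_content G \<le> outer (A i) + ennreal (d i)" for i
    by (rule outer_approx[OF assms d])
  then obtain G where G: "\<And>i. openin X (G i)" "\<And>i. A i \<subseteq> G i"
      "\<And>i. inner_content (G i) \<le> outer (A i) + ennreal (d i)"
    by metis
  have "(\<lambda>i. e * (1/2) ^ Suc i) sums (e * 1)"
    by (rule sums_mult[OF power_half_series])
  then have "d sums e"
    by (simp only: d_def[abs_def] mult_1_right)
  then have sum_d: "(\<Sum>i. ennreal (d i)) = ennreal e"
    using d by (intro suminf_ennreal_eq less_imp_le)
  have "outer (\<Union>i. A i) \<le> outer (\<Union>i. G i)"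
    using G(2) by (intro outer_mono) blast
  also have "\<dots> = inner_content (\<Union>i. G i)"
    using G(1) by (intro outer_open) auto
  also have "\<dots> \<le> (\<Sum>i. inner_content (G i))"
    by (rule inner_content_UN[OF G(1)])
  also have "\<dots> \<le> (\<Sum>i. outer (A i) + ennreal (d i))"
    using G(3) by (intro suminf_le) auto
  also have "\<dots> = (\<Sum>i. outer (A i)) + ennreal e"
    by (simp add: suminf_add[symmetric] sum_d)
  finally show "outer (\<Union>i. A i) \<le> (\<Sum>i. outer (A i)) + ennreal e" .
qed

lemma outer_empty: "outer {} = 0"
  using outer_open[of "{}"] by (simp add: inner_content_empty)

lemma outer_measure_space_outer: "outer_measure_space (Pow (topspace X)) outer"
  unfolding outer_measure_space_def positive_def increasing_def countably_subadditive_def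
  by (auto intro!: outer_empty outer_mono outer_UN)

text \<open>The Caratheodory condition for the open set \<open>G\<close>, tested on open sets only.\<close>

lemma inner_content_split:
  assumes G: "openin X G" and H: "openin X H"
  shows "inner_content (H \<inter> G) + outer (H - G) \<le> inner_content H"
proof -
  \<comment> \<open>Any closed L in H - K is disjoint from K, and K \<union> L is a closed subset of
    H. The supremum over L bounds the second summand; the supremum over K is taken
    afterwards.\<close>
  have "\<nu> K + outer (H - G) \<le> inner_content H" if K: "closedin X K" "K \<subseteq> H \<inter> G" for K
  proof -
    have "openin X (H - K)"
      using H K by (simp add: openin_diff)
    have "outer (H - G) \<le> outer (H - K)"
      using K by (intro outer_mono) auto
    also have "\<dots> = inner_content (H - K)"
      by (rule outer_open) fact
    finally have "\<nu> K + outer (H - G) \<le> \<nu> K + inner_content (H - K)"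
      by (rule add_left_mono)
    also have "\<dots> = (SUP L\<in>{L. closedin X L \<and> L \<subseteq> H - K}. \<nu> K + \<nu> L)"
      unfolding inner_content_def by (rule ennreal_SUP_add_right) auto
    also have "\<dots> \<le> inner_content H"
    proof (rule SUP_least)
      fix L assume "L \<in> {L. closedin X L \<and> L \<subseteq> H - K}"
      then have L: "closedin X L" "L \<subseteq> H - K" by auto
      then have "\<nu> K + \<nu> L = \<nu> (K \<union> L)"
        by (intro additive[symmetric]) auto
      also have "\<dots> \<le> inner_content H"
        using K L by (intro inner_content_upper closedin_Un) auto
      finally show "\<nu> K + \<nu> L \<le> inner_content H" .
    qed
    finally show ?thesis .
  qed
  moreover have "inner_content (H \<inter> G) + outer (H - G) =
      (SUP K\<in>{K. closedin X K \<and> K \<subseteq> H \<inter> G}. \<nu> K + outer (H - G))"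
    unfolding inner_content_def by (rule ennreal_SUP_add_left[symmetric]) auto
  ultimately show ?thesis
    by (auto intro!: SUP_least)
qed

text \<open>\<open>inner_content_split\<close> gives the nontrivial inequality for every open H
  containing A, and the infimum over H passes it to A. The converse is subadditivity.\<close>

lemma open_in_lambda_system:
  assumes "openin X G"
  shows "G \<in> lambda_system (topspace X) (Pow (topspace X)) outer"
  unfolding lambda_system_def
proof (intro CollectI conjI ballI)
  show "G \<in> Pow (topspace X)"
    using assms openin_subset by auto
  fix A assume "A \<in> Pow (topspace X)"
  then have A: "A \<subseteq> topspace X" by simp
  show "outer (G \<inter> A) + outer ((topspace X - G) \<inter> A) = outer A"
  proof (rule antisym)
    show "outer (G \<inter> A) + outer ((topspace X - G) \<inter> A) \<le> outer A"
      unfolding outer_def[of A]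
    proof (rule INF_greatest)
      fix H assume "H \<in> {H. openin X H \<and> A \<subseteq> H}"
      then have H: "openin X H" "A \<subseteq> H" by auto
      have "outer (G \<inter> A) + outer ((topspace X - G) \<inter> A) \<le> outer (H \<inter> G) + outer (H - G)"
        using H by (intro add_mono outer_mono) auto
      also have "outer (H \<inter> G) = inner_content (H \<inter> G)"
        using H assms by (intro outer_open) auto
      also have "inner_content (H \<inter> G) + outer (H - G) \<le> inner_content H"
        by (rule inner_content_split[OF assms H(1)])
      finally show "outer (G \<inter> A) + outer ((topspace X - G) \<inter> A) \<le> inner_content H" .
    qed
    have "subadditive (Pow (topspace X)) outer"
      using outer_measure_space_outer sigma_algebra_Pow[of "topspace X"]
        ring_of_sets.countably_subadditive_subadditive
      unfolding outer_measure_space_def sigma_algebra_def algebra_def by blast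
    then have "outer ((G \<inter> A) \<union> ((topspace X - G) \<inter> A)) \<le> outer (G \<inter> A) + outer ((topspace X - G) \<inter> A)"
      by (rule subadditiveD) (use A in auto)
    also have "(G \<inter> A) \<union> ((topspace X - G) \<inter> A) = A"
      using A by auto
    finally show "outer A \<le> outer (G \<inter> A) + outer ((topspace X - G) \<inter> A)" .
  qed
qed

lemma measure_extending_inner_content:
  "\<exists>\<mu>. space \<mu> = topspace X \<and> sets \<mu> = sigma_sets (topspace X) {U. openin X U} \<and>
    (\<forall>U. openin X U \<longrightarrow> emeasure \<mu> U = inner_content U)"
proof -
  let ?B = "sigma_sets (topspace X) {U. openin X U}"
  let ?L = "lambda_system (topspace X) (Pow (topspace X)) outer"
  interpret P: sigma_algebra "topspace X" "Pow (topspace X)"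
    by (rule sigma_algebra_Pow)
  have L: "measure_space (topspace X) ?L outer"
    by (rule P.caratheodory_lemma[OF outer_measure_space_outer])
  then have "?B \<subseteq> ?L"
    by (intro sigma_algebra.sigma_sets_subset)
       (auto simp: measure_space_def intro: open_in_lambda_system)
  have "sigma_algebra (topspace X) ?B"
    by (intro sigma_algebra_sigma_sets) (auto dest: openin_subset)
  then have ms: "measure_space (topspace X) ?B outer"
    using L \<open>?B \<subseteq> ?L\<close> unfolding measure_space_def countably_additive_def positive_def
    by (meson order_trans subsetD)
  define \<mu> where "\<mu> = measure_of (topspace X) {U. openin X U} outer"
  have sub: "{U. openin X U} \<subseteq> Pow (topspace X)"
    by (auto dest: openin_subset)
  show ?thesis
  proof (intro exI conjI allI impI)
    show "space \<mu> = topspace X"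
      unfolding \<mu>_def using sub by (rule space_measure_of)
    show sets: "sets \<mu> = ?B"
      unfolding \<mu>_def using sub by (rule sets_measure_of)
    fix U assume U: "openin X U"
    have "emeasure \<mu> U = outer U"
      using ms U unfolding measure_space_def
      by (intro emeasure_measure_of[OF \<mu>_def sub]) (auto simp: sets)
    with U show "emeasure \<mu> U = inner_content U"
      by (simp add: outer_open)
  qed
qed

end

section \<open>Upper Banach density and invariant contents\<close>

text \<open>Replaces the limit superior by a uniform frequency \<delta> on arbitrarily long blocks,
  the form in which blocks of visits can be moved along an orbit. The condition \<open>0 < n\<close>
  excludes the empty interval when \<open>N = 0\<close>.\<close>

lemma F_pubd_iff:
  "F \<in> F_pubd \<longleftrightarrow>
    (\<exists>\<delta>>0. \<forall>N. \<exists>a n. N \<le> n \<and> 0 < n \<and> \<delta> * real n \<le> real (card (F \<inter> {a..<a + n})))"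
    (is "_ \<longleftrightarrow> ?R")
proof -
  let ?G = "inf (filtercomap card at_top) (principal nat_intervals)"
  have intervals: "I \<in> nat_intervals \<longleftrightarrow> (\<exists>a n. 0 < n \<and> I = {a..<a + n})" for I :: "nat set"
  proof
    assume "I \<in> nat_intervals"
    then obtain m n where "I = {m..n}" "m \<le> n"
      by (auto simp: nat_intervals_def)
    then show "\<exists>a n. 0 < n \<and> I = {a..<a + n}"
      by (intro exI[of _ m] exI[of _ "Suc n - m"]) auto
  next
    assume "\<exists>a n. 0 < n \<and> I = {a..<a + n}"
    then obtain a n where "0 < n" "I = {a..<a + n}" by auto
    then show "I \<in> nat_intervals"
      unfolding nat_intervals_def mem_Collect_eq
      by (intro exI[of _ a] exI[of _ "a + n - 1"]) auto
  qed
  have ev: "eventually P ?G \<longleftrightarrow> (\<exists>N. \<forall>a n. N \<le> n \<and> 0 < n \<longrightarrow> P {a..<a + n})" for P :: "nat set \<Rightarrow> bool"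
  proof
    assume "eventually P ?G"
    then obtain N where N: "\<And>I. N \<le> card I \<Longrightarrow> I \<in> nat_intervals \<longrightarrow> P I"
      unfolding eventually_inf_principal eventually_filtercomap eventually_at_top_linorder by auto
    have "P {a..<a + n}" if "N \<le> n" "0 < n" for a n
      using N[of "{a..<a + n}"] that intervals by auto
    then show "\<exists>N. \<forall>a n. N \<le> n \<and> 0 < n \<longrightarrow> P {a..<a + n}"
      by blast
  next
    assume "\<exists>N. \<forall>a n. N \<le> n \<and> 0 < n \<longrightarrow> P {a..<a + n}"
    then obtain N where N: "\<forall>a n. N \<le> n \<and> 0 < n \<longrightarrow> P {a..<a + n}" by auto
    show "eventually P ?G"
      unfolding eventually_inf_principal eventually_filtercomap eventually_at_top_linorder
    proof (intro exI[of _ "\<lambda>n. N \<le> n"] conjI allI impI)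
      fix I assume "N \<le> card I" "I \<in> nat_intervals"
      then show "P I"
        using N intervals by auto
    qed auto
  qed
  have "F \<in> F_pubd \<longleftrightarrow>
      (\<exists>y>0. \<not> eventually (\<lambda>I. ereal (real (card (F \<inter> I)) / real (card I)) < y) ?G)"
    unfolding F_pubd_def upper_Banach_density_def mem_Collect_eq
    using Limsup_le_iff[of ?G "\<lambda>I. ereal (real (card (F \<inter> I)) / real (card I))" 0]
    by (meson not_le)
  also have "\<dots> \<longleftrightarrow>
      (\<exists>y>0. \<forall>N. \<exists>a n. N \<le> n \<and> 0 < n \<and> y \<le> ereal (real (card (F \<inter> {a..<a + n})) / real n))"
    unfolding ev by (simp add: not_less)
  also have "\<dots> \<longleftrightarrow> ?R"
  proof
    assume "\<exists>y>0. \<forall>N. \<exists>a n. N \<le> n \<and> 0 < n \<and> y \<le> ereal (real (card (F \<inter> {a..<a + n})) / real n)"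
    then obtain y where y: "0 < y"
      "\<And>N. \<exists>a n. N \<le> n \<and> 0 < n \<and> y \<le> ereal (real (card (F \<inter> {a..<a + n})) / real n)" by blast
    \<comment> \<open>The bound \<open>y\<close> is an extended real, but it lies below a finite
      ratio and above 0.\<close>
    have "\<bar>y\<bar> \<noteq> \<infinity>"
      using y(1) y(2)[of 0] by (cases y) auto
    then obtain \<delta> where "y = ereal \<delta>" by (cases y) auto
    moreover have "y \<le> ereal (c / real n) \<longleftrightarrow> \<delta> * real n \<le> c" if "0 < n" for c n
      using that \<open>y = ereal \<delta>\<close> by (simp add: pos_le_divide_eq)
    ultimately show ?R
      using y by (intro exI[of _ \<delta>]) (metis ereal_less(2))
  next
    assume ?R
    then obtain \<delta> where d: "0 < \<delta>"
      "\<And>N. \<exists>a n. N \<le> n \<and> 0 < n \<and> \<delta> * real n \<le> real (card (F \<inter> {a..<a + n}))" by blast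
    then show "\<exists>y>0. \<forall>N. \<exists>a n. N \<le> n \<and> 0 < n \<and> y \<le> ereal (real (card (F \<inter> {a..<a + n})) / real n)"
      by (intro exI[of _ "ereal \<delta>"]) (metis ereal_less(2) ereal_less_eq(3) of_nat_0_less_iff pos_le_divide_eq)
  qed
  finally show ?thesis .
qed

lemma F_pubd_nonempty: "F \<in> F_pubd \<Longrightarrow> F \<noteq> {}"
  by (auto simp: F_pubd_iff mult_le_0_iff)

definition finitely_additive_invariant :: "(nat set \<Rightarrow> real) \<Rightarrow> bool" where
  "finitely_additive_invariant m \<longleftrightarrow> (\<forall>A. 0 \<le> m A) \<and> m UNIV = 1 \<and>
     (\<forall>A B. A \<inter> B = {} \<longrightarrow> m (A \<union> B) = m A + m B) \<and> (\<forall>A. m (Suc -` A) = m A)"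

text \<open>Translating by one can gain or lose only a point at an end of the interval. Divided by
  the length, this error vanishes in the limit and makes the limiting content shift
  invariant.\<close>

lemma card_shift_interval:
  fixes a n :: nat and A :: "nat set"
  shows "\<bar>real (card (Suc -` A \<inter> {a..<a + n})) - real (card (A \<inter> {a..<a + n}))\<bar> \<le> 1"
proof -
  let ?I = "{a..<a + n}"
  have img: "Suc ` (Suc -` A \<inter> ?I) \<subseteq> insert (a + n) (A \<inter> ?I)"
    by auto
  have "card (Suc -` A \<inter> ?I) = card (Suc ` (Suc -` A \<inter> ?I))"
    by (simp add: card_image)
  also have "\<dots> \<le> card (insert (a + n) (A \<inter> ?I))"
    by (rule card_mono[OF _ img]) simp
  also have "\<dots> \<le> Suc (card (A \<inter> ?I))"
    by (rule card_insert_le_m1) auto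
  finally have 1: "card (Suc -` A \<inter> ?I) \<le> Suc (card (A \<inter> ?I))" .
  have "A \<inter> ?I \<subseteq> insert a (Suc ` (Suc -` A \<inter> ?I))"
  proof
    fix k assume "k \<in> A \<inter> ?I"
    then show "k \<in> insert a (Suc ` (Suc -` A \<inter> ?I))"
      by (cases k) auto
  qed
  then have "card (A \<inter> ?I) \<le> card (insert a (Suc ` (Suc -` A \<inter> ?I)))"
    by (intro card_mono) auto
  also have "\<dots> \<le> Suc (card (Suc ` (Suc -` A \<inter> ?I)))"
    by (rule card_insert_le_m1) auto
  also have "\<dots> = Suc (card (Suc -` A \<inter> ?I))"
    by (simp add: card_image)
  finally have 2: "card (A \<inter> ?I) \<le> Suc (card (Suc -` A \<inter> ?I))" .
  from 1 2 show ?thesis by linarith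
qed

text \<open>The content is a cluster point, in the compact space \<open>[0,1]\<^sup>P\<^sup>(\<^sup>\<nat>\<^sup>)\<close>, of the relative frequencies on longer and
  longer intervals.\<close>

lemma pubd_imp_invariant_content:
  assumes "F \<in> F_pubd"
  shows "\<exists>m. finitely_additive_invariant m \<and> 0 < m F"
proof -
  obtain \<delta> where \<delta>: "0 < \<delta>"
    "\<And>N. \<exists>a n. N \<le> n \<and> 0 < n \<and> \<delta> * real n \<le> real (card (F \<inter> {a..<a + n}))"
    using assms unfolding F_pubd_iff by blast
  then obtain a n :: "nat \<Rightarrow> nat" where an: "\<And>N. N \<le> n N" "\<And>N. 0 < n N"
    "\<And>N. \<delta> * real (n N) \<le> real (card (F \<inter> {a N..<a N + n N}))"
    by metis
  define d where "d N A = real (card (A \<inter> {a N..<a N + n N})) / real (n N)" for N A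
  let ?K = "PiE UNIV (\<lambda>_::nat set. {0..1::real})"
  have "compactin (product_topology (\<lambda>_. euclidean) UNIV) ?K"
    by (simp add: compactin_PiE)
  then have "compact ?K"
    by (simp add: euclidean_product_topology)
  moreover have "d N \<in> ?K" for N
  proof -
    have "card (A \<inter> {a N..<a N + n N}) \<le> n N" for A
      using card_mono[of "{a N..<a N + n N}" "A \<inter> {a N..<a N + n N}"] by simp
    then show ?thesis
      using an(2) by (auto simp: d_def)
  qed
  then have "eventually (\<lambda>g. g \<in> ?K) (filtermap d sequentially)"
    by (simp add: eventually_filtermap)
  moreover have "filtermap d sequentially \<noteq> bot"
    by (simp add: filtermap_bot_iff)
  ultimately obtain m where m: "inf (nhds m) (filtermap d sequentially) \<noteq> bot"
    unfolding compact_filter by meson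
  \<comment> \<open>A cluster point need not be the limit of a subsequence in this large product.
    \<open>G\<close> is a filter on the indices, finer than \<open>sequentially\<close>, along which
    \<open>d\<close> converges to \<open>m\<close> in every coordinate; it takes the place of a
    convergent subnet.\<close>
  define G where "G = inf (filtercomap d (nhds m)) sequentially"
  have G: "G \<noteq> bot"
  proof
    assume "G = bot"
    then have "eventually (\<lambda>_. False) G" by simp
    then obtain P Q where P: "eventually P (nhds m)" and Q: "eventually Q sequentially"
      and PQ: "\<And>x. P (d x) \<Longrightarrow> Q x \<Longrightarrow> False"
      unfolding G_def eventually_inf eventually_filtercomap by blast
    have "eventually (\<lambda>y. \<not> P y) (filtermap d sequentially)"
      unfolding eventually_filtermap using Q by (rule eventually_mono) (use PQ in blast)
    with P have "eventually (\<lambda>_. False) (inf (nhds m) (filtermap d sequentially))"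
      unfolding eventually_inf by blast
    with m show False
      by (simp add: eventually_False)
  qed
  have "filterlim d (nhds m) G"
    unfolding G_def by (rule filterlim_mono[OF filterlim_filtercomap]) auto
  then have lim: "((\<lambda>N. d N A) \<longlongrightarrow> m A) G" for A
    using continuous_on_tendsto_compose[OF continuous_on_product_coordinates[of A], of d m G]
    by simp
  have "(\<lambda>N. 1 / real (n N)) \<longlonglongrightarrow> 0"
  proof (rule tendsto_sandwich[OF _ _ tendsto_const])
    show "(\<lambda>N. 1 / real N) \<longlonglongrightarrow> 0"
      by (rule lim_1_over_n)
    show "eventually (\<lambda>N. 1 / real (n N) \<le> 1 / real N) sequentially"
      using eventually_gt_at_top[of 0]
      by eventually_elim (use an in \<open>auto intro!: divide_left_mono\<close>)
  qed auto
  then have small: "((\<lambda>N. 1 / real (n N)) \<longlongrightarrow> 0) G"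
    unfolding G_def by (rule tendsto_mono[rotated]) simp
  have "finitely_additive_invariant m"
    unfolding finitely_additive_invariant_def
  proof (intro conjI allI impI)
    show "0 \<le> m A" for A
      by (rule tendsto_lowerbound[OF lim]) (use G in \<open>auto simp: d_def\<close>)
    have "((\<lambda>N. d N UNIV) \<longlongrightarrow> 1) G"
      using an(2) by (simp add: d_def less_imp_neq[symmetric])
    then show "m UNIV = 1"
      by (rule tendsto_unique[OF G lim])
    show "m (A \<union> B) = m A + m B" if "A \<inter> B = {}" for A B
    proof -
      have "d N (A \<union> B) = d N A + d N B" for N
      proof -
        have "card ((A \<union> B) \<inter> {a N..<a N + n N}) =
            card (A \<inter> {a N..<a N + n N}) + card (B \<inter> {a N..<a N + n N})"
          using that by (subst Int_Un_distrib2, intro card_Un_disjoint) auto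
        then show ?thesis
          by (simp add: d_def add_divide_distrib)
      qed
      then have "((\<lambda>N. d N (A \<union> B)) \<longlongrightarrow> m A + m B) G"
        using tendsto_add[OF lim lim] by simp
      then show ?thesis
        by (rule tendsto_unique[OF G lim])
    qed
    show "m (Suc -` A) = m A" for A
    proof -
      have "\<bar>d N (Suc -` A) - d N A\<bar> \<le> 1 / real (n N)" for N
        using card_shift_interval[of A "a N" "n N"] an(2)
        by (simp add: d_def diff_divide_distrib[symmetric] divide_right_mono)
      then have "((\<lambda>N. d N (Suc -` A) - d N A) \<longlongrightarrow> 0) G"
        by (intro tendsto_rabs_zero_cancel[OF tendsto_sandwich[OF _ _ tendsto_const small]]) auto
      moreover have "((\<lambda>N. d N (Suc -` A) - d N A) \<longlongrightarrow> m (Suc -` A) - m A) G"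
        by (intro tendsto_diff lim)
      ultimately have "0 = m (Suc -` A) - m A"
        by (rule tendsto_unique[OF G])
      then show ?thesis by simp
    qed
  qed
  \<comment> \<open>The intervals were chosen so that every single frequency of \<open>F\<close> is
    at least \<delta>, hence so is the limit.\<close>
  moreover have "\<delta> \<le> m F"
    by (rule tendsto_lowerbound[OF lim]) (use G an in \<open>auto simp: d_def field_simps\<close>)
  ultimately show ?thesis
    using \<delta>(1) by (metis less_le_trans)
qed

section \<open>Invariant contents and the pigeonhole principle\<close>

context
  fixes m assumes m: "finitely_additive_invariant m"
begin

lemma content_nonneg: "0 \<le> m A"
  and content_UNIV: "m UNIV = 1"
  and content_Un: "A \<inter> B = {} \<Longrightarrow> m (A \<union> B) = m A + m B"
  and content_Suc: "m (Suc -` A) = m A"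
  using m by (auto simp: finitely_additive_invariant_def)

lemma content_empty: "m {} = 0"
  using content_Un[of "{}" "{}"] by simp

lemma content_mono: "A \<subseteq> B \<Longrightarrow> m A \<le> m B"
  using content_Un[of A "B - A"] content_nonneg[of "B - A"] by (simp add: Un_absorb1)

lemma content_shift: "m ((\<lambda>n. n + k) -` A) = m A"
proof (induction k)
  case (Suc k)
  have "(\<lambda>n. n + Suc k) -` A = Suc -` ((\<lambda>n. n + k) -` A)"
    by auto
  then show ?case
    using Suc content_Suc by simp
qed simp

lemma content_UN_disjoint:
  assumes "finite I" "\<And>i j. i \<in> I \<Longrightarrow> j \<in> I \<Longrightarrow> i \<noteq> j \<Longrightarrow> A i \<inter> A j = {}"
  shows "m (\<Union>i\<in>I. A i) = (\<Sum>i\<in>I. m (A i))"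
  using assms
proof (induction I)
  case (insert i I)
  have "A i \<inter> A j = {}" if "j \<in> I" for j
    using insert.prems[of i j] insert.hyps(2) that by blast
  then have "A i \<inter> (\<Union>j\<in>I. A j) = {}"
    by blast
  moreover have "m (\<Union>j\<in>I. A j) = (\<Sum>j\<in>I. m (A j))"
    using insert.prems by (intro insert.IH) blast
  ultimately show ?case
    using insert.hyps by (simp add: content_Un)
qed (simp add: content_empty)

text \<open>All translates of \<open>F\<close> have content \<open>m F\<close>, and more than 1 /
  \<open>m F\<close> of them cannot be disjoint in a space of content 1. The bound \<open>N\<close>
  depends on \<open>F\<close> only, not on \<open>s\<close>, so a finite sequence of suitable length
  may be chosen afterwards.\<close>

lemma content_pigeonhole:
  assumes "0 < m F"
  shows "\<exists>N. \<forall>s :: nat \<Rightarrow> nat. \<exists>i j n. i < j \<and> j \<le> N \<and> n + s i \<in> F \<and> n + s j \<in> F"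
proof -
  obtain N :: nat where N: "1 / m F < real N"
    using reals_Archimedean2 by blast
  have "\<exists>i j n. i < j \<and> j \<le> N \<and> n + s i \<in> F \<and> n + s j \<in> F" for s :: "nat \<Rightarrow> nat"
  proof (rule ccontr)
    assume contra: "\<not> ?thesis"
    let ?A = "\<lambda>i. (\<lambda>n. n + s i) -` F"
    have "?A i \<inter> ?A j = {}" if "i \<in> {..N}" "j \<in> {..N}" "i \<noteq> j" for i j
    proof (rule ccontr)
      assume "?A i \<inter> ?A j \<noteq> {}"
      then obtain n where n: "n + s i \<in> F" "n + s j \<in> F" by blast
      have "i < j \<or> j < i" "i \<le> N" "j \<le> N"
        using that by auto
      with contra n show False by blast
    qed
    then have "m (\<Union>i\<le>N. ?A i) = (\<Sum>i\<le>N. m (?A i))"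
      by (intro content_UN_disjoint) auto
    also have "\<dots> = real (Suc N) * m F"
      by (simp add: content_shift)
    finally have "real (Suc N) * m F \<le> 1"
      using content_mono[of "\<Union>i\<le>N. ?A i" UNIV] content_UNIV by simp
    moreover have "1 < real N * m F"
      using N assms by (simp add: field_simps)
    moreover have "real N * m F \<le> real (Suc N) * m F"
      using assms by simp
    ultimately show False by linarith
  qed
  then show ?thesis by blast
qed

end

section \<open>D-sets and weak mixing\<close>

lemma F_pubd_unbounded:
  assumes "F \<in> F_pubd"
  shows "\<exists>n\<in>F. k \<le> n"
proof (rule ccontr)
  assume "\<not> ?thesis"
  then have sub: "F \<subseteq> {..<k}" by force
  obtain \<delta> where \<delta>: "0 < \<delta>"
    "\<And>N. \<exists>a n. N \<le> n \<and> 0 < n \<and> \<delta> * real n \<le> real (card (F \<inter> {a..<a + n}))"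
    using assms unfolding F_pubd_iff by blast
  obtain N :: nat where N: "real k / \<delta> < real N"
    using reals_Archimedean2 by blast
  obtain a n where n: "N \<le> n" "\<delta> * real n \<le> real (card (F \<inter> {a..<a + n}))"
    using \<delta>(2) by blast
  have "card (F \<inter> {a..<a + n}) \<le> card {..<k}"
    using sub by (intro card_mono) auto
  with n(2) have "\<delta> * real n \<le> real k" by simp
  moreover have "real k < \<delta> * real N"
    using N \<delta>(1) by (simp add: field_simps)
  moreover have "\<delta> * real N \<le> \<delta> * real n"
    using n(1) \<delta>(1) by simp
  ultimately show False by linarith
qed

section \<open>Iterates, hitting times and open preimages\<close>

lemma funpow_commute: "(T ^^ m) ((T ^^ n) x) = (T ^^ n) ((T ^^ m) x)"
  by (metis add.commute comp_apply funpow_add)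

lemma hitting_times_iff: "n \<in> hitting_times T U V \<longleftrightarrow> (\<exists>u\<in>U. (T ^^ n) u \<in> V)"
  by (auto simp: hitting_times_def)

lemma opene_prod_box:
  assumes "opene (prod_metric X Y) W"
  obtains A B where "opene X A" "opene Y B" "A \<times> B \<subseteq> W"
proof -
  obtain x y where xy: "(x, y) \<in> W"
    using assms unfolding opene_def by auto
  have "openin (prod_topology (mtopology_of X) (mtopology_of Y)) W"
    using assms by (simp add: opene_def)
  then have "\<exists>A B. openin (mtopology_of X) A \<and> openin (mtopology_of Y) B \<and> x \<in> A \<and> y \<in> B \<and> A \<times> B \<subseteq> W"
    using xy unfolding openin_prod_topology_alt by simp
  then show thesis
    using that unfolding opene_def by blast
qed

text \<open>\<open>T\<close> is arbitrary off the carrier, so the carrier is built in to keep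
  preimages of open sets open.\<close>

definition preimage :: "'a metric \<Rightarrow> ('a \<Rightarrow> 'a) \<Rightarrow> nat \<Rightarrow> 'a set \<Rightarrow> 'a set" where
  "preimage X T n U = {x \<in> mspace X. (T ^^ n) x \<in> U}"

context
  fixes X :: "'a metric" and T :: "'a \<Rightarrow> 'a"
  assumes TDS: "TDS X T"
begin

lemma continuous_map_funpow: "continuous_map (mtopology_of X) (mtopology_of X) (T ^^ n)"
proof (induction n)
  case (Suc n)
  then show ?case
    using TDS continuous_map_compose unfolding TDS_def funpow.simps(2) by blast
qed simp

lemma funpow_in_mspace: "x \<in> mspace X \<Longrightarrow> (T ^^ n) x \<in> mspace X"
  using continuous_map_funpow[of n] by (auto simp: continuous_map_def)

lemma openin_preimage: "openin (mtopology_of X) U \<Longrightarrow> openin (mtopology_of X) (preimage X T n U)"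
  using openin_continuous_map_preimage[OF continuous_map_funpow, of U n] by (simp add: preimage_def)

text \<open>A finite pattern of visits to an open set persists nearby. An orbit that enters this set
  therefore copies the whole pattern; this is how orbits are made to shadow one another
  below.\<close>

lemma openin_preimages:
  assumes "finite J" "openin (mtopology_of X) V"
  shows "openin (mtopology_of X) {z \<in> mspace X. \<forall>j\<in>J. (T ^^ j) z \<in> V}"
  using assms(1)
proof (induction J)
  case empty
  then show ?case
    using openin_topspace[of "mtopology_of X"] by simp
next
  case (insert j J)
  have "{z \<in> mspace X. \<forall>j\<in>insert j J. (T ^^ j) z \<in> V} =
      preimage X T j V \<inter> {z \<in> mspace X. \<forall>j\<in>J. (T ^^ j) z \<in> V}"
    by (auto simp: preimage_def)
  then show ?case
    using openin_preimage[OF assms(2)] insert.IH by (simp add: openin_Int)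
qed

text \<open>Since the orbit of (a, b) comes arbitrarily close to (b, b), both orbits at once copy
  any finite pattern of visits of b to V. Copying long dense blocks gives the density. Copying
  repeatedly gives long sequences with all differences in \<open>D\<close>, and the pigeonhole
  principle for translates of \<open>G\<close> selects one difference.\<close>

lemma D_set_from_properties:
  assumes "D_set_from X T F"
  shows "F \<in> F_pubd" and "G \<in> F_pubd \<Longrightarrow> \<exists>k\<in>F. \<exists>n. n \<in> G \<and> n + k \<in> G"
proof -
  obtain a b U where a: "a \<in> mspace X" and b: "recurrent_point F_pubd X T b"
    and U: "neighborhood X b U"
    and cl: "(b, b) \<in> mtopology_of (prod_metric X X) closure_of orb (map_prod T T) (a, b)"
    and F: "visit_times (map_prod T T) (a, b) (U \<times> U) \<subseteq> F"
    using assms unfolding D_set_from_def by blast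
  obtain V where V: "openin (mtopology_of X) V" "b \<in> V" "V \<subseteq> U"
    using U unfolding neighborhood_def by blast
  have bX: "b \<in> mspace X"
    using b by (simp add: recurrent_point_def)
  define D where "D = {n. (T ^^ n) a \<in> V \<and> (T ^^ n) b \<in> V}"
  have DF: "D \<subseteq> F"
    using F V(3) by (auto simp: D_def visit_times_def funpow_map_prod)
  have approach: "\<exists>n. (T ^^ n) a \<in> W \<and> (T ^^ n) b \<in> W"
    if W: "openin (mtopology_of X) W" "b \<in> W" for W
  proof -
    have "openin (mtopology_of (prod_metric X X)) (W \<times> W)"
      using W(1) by (simp add: openin_prod_Times_iff)
    then obtain p where "p \<in> orb (map_prod T T) (a, b)" "p \<in> W \<times> W"
      using cl[unfolded in_closure_of, THEN conjunct2, rule_format, of "W \<times> W"] W(2) by blast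
    then show ?thesis
      by (auto simp: orb_def funpow_map_prod)
  qed
  show "F \<in> F_pubd"
  proof -
    have "neighborhood X b V"
      using V(1,2) openin_subset[OF V(1)] unfolding neighborhood_def topspace_mtopology_of by blast
    then have "visit_times T b V \<in> F_pubd"
      using b unfolding recurrent_point_def by blast
    then obtain \<delta> where \<delta>: "0 < \<delta>" "\<And>N. \<exists>a n. N \<le> n \<and> 0 < n \<and>
        \<delta> * real n \<le> real (card (visit_times T b V \<inter> {a..<a + n}))"
      unfolding F_pubd_iff by blast
    have "\<exists>c n. N \<le> n \<and> 0 < n \<and> \<delta> * real n \<le> real (card (F \<inter> {c..<c + n}))" for N
    proof -
      obtain c n where cn: "N \<le> n" "0 < n"
        "\<delta> * real n \<le> real (card (visit_times T b V \<inter> {c..<c + n}))"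
        using \<delta>(2) by blast
      define J where "J = visit_times T b V \<inter> {c..<c + n}"
      have 1: "openin (mtopology_of X) {z \<in> mspace X. \<forall>j\<in>J. (T ^^ j) z \<in> V}"
        by (rule openin_preimages[OF _ V(1)]) (simp add: J_def)
      have 2: "b \<in> {z \<in> mspace X. \<forall>j\<in>J. (T ^^ j) z \<in> V}"
        using bX by (auto simp: J_def visit_times_def)
      obtain k where k: "\<And>j. j \<in> J \<Longrightarrow> (T ^^ j) ((T ^^ k) a) \<in> V"
        "\<And>j. j \<in> J \<Longrightarrow> (T ^^ j) ((T ^^ k) b) \<in> V"
        using approach[OF 1 2] by blast
      have "(\<lambda>j. j + k) ` J \<subseteq> D"
        using k by (auto simp: D_def funpow_add)
      moreover have "(\<lambda>j. j + k) ` J \<subseteq> {c + k..<c + k + n}"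
        by (auto simp: J_def)
      ultimately have "(\<lambda>j. j + k) ` J \<subseteq> F \<inter> {c + k..<c + k + n}"
        using DF by blast
      then have "card ((\<lambda>j. j + k) ` J) \<le> card (F \<inter> {c + k..<c + k + n})"
        by (intro card_mono) auto
      moreover have "card ((\<lambda>j. j + k) ` J) = card J"
        by (simp add: card_image inj_on_def)
      ultimately have "\<delta> * real n \<le> real (card (F \<inter> {c + k..<c + k + n}))"
        using cn(3) unfolding J_def[symmetric] by linarith
      with cn(1,2) show ?thesis by blast
    qed
    with \<delta>(1) show ?thesis
      unfolding F_pubd_iff by blast
  qed
  \<comment> \<open>A sequence is extended at its front: choosing \<open>n\<close> with \<open>T\<^sup>n a\<close> and \<open>T\<^sup>n b\<close> close enough to \<open>b\<close>,
    all old terms are moved by \<open>n\<close>.\<close>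
  have differences: "\<exists>s :: nat \<Rightarrow> nat. \<forall>i j. i < j \<and> j \<le> N \<longrightarrow> s i \<le> s j \<and> s j - s i \<in> D" for N
  proof (induction N)
    case (Suc N)
    then obtain s :: "nat \<Rightarrow> nat" where s: "\<And>i j. i < j \<Longrightarrow> j \<le> N \<Longrightarrow> s i \<le> s j \<and> s j - s i \<in> D"
      by blast
    \<comment> \<open>These are the times at which b must visit V for the next copy. The case
      \<open>j = 0\<close> contributes time 0, a visit because b itself lies in V.\<close>
    define K where "K = (\<lambda>j. s j - s 0) ` {..N}"
    have s0: "s 0 \<le> s j" if "j \<le> N" for j
      using s[of 0 j] that by (cases "j = 0") auto
    have "(T ^^ (s j - s 0)) b \<in> V" if "j \<le> N" for j
      using s[of 0 j] that V(2) by (cases "j = 0") (auto simp: D_def)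
    then have 1: "b \<in> {z \<in> mspace X. \<forall>j\<in>K. (T ^^ j) z \<in> V}"
      using bX by (auto simp: K_def)
    have 2: "openin (mtopology_of X) {z \<in> mspace X. \<forall>j\<in>K. (T ^^ j) z \<in> V}"
      by (rule openin_preimages[OF _ V(1)]) (simp add: K_def)
    obtain n where n: "\<And>j. j \<in> K \<Longrightarrow> (T ^^ j) ((T ^^ n) a) \<in> V"
        "\<And>j. j \<in> K \<Longrightarrow> (T ^^ j) ((T ^^ n) b) \<in> V"
      using approach[OF 2 1] by blast
    \<comment> \<open>The first term stays and all the old terms move by \<open>n\<close>: old
      differences are unchanged, and the new ones, \<open>n\<close> plus an element of
      \<open>K\<close>, lie in \<open>D\<close> by the choice of \<open>n\<close>.\<close>
    define s' where "s' j = (case j of 0 \<Rightarrow> s 0 | Suc j \<Rightarrow> n + s j)" for j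
    have "s' i \<le> s' j \<and> s' j - s' i \<in> D" if ij: "i < j" "j \<le> Suc N" for i j
    proof -
      obtain j' where j': "j = Suc j'" "j' \<le> N"
        using ij by (cases j) auto
      show ?thesis
      proof (cases i)
        case 0
        have "s j' - s 0 \<in> K"
          using j' by (auto simp: K_def)
        then have "s j' - s 0 + n \<in> D"
          using n by (simp add: D_def funpow_add)
        then show ?thesis
          using 0 j' s0[of j'] by (simp add: s'_def add.commute)
      next
        case (Suc i')
        then show ?thesis
          using j' s[of i' j'] ij by (simp add: s'_def)
      qed
    qed
    then show ?case by blast
  qed auto
  show "\<exists>k\<in>F. \<exists>n. n \<in> G \<and> n + k \<in> G" if G: "G \<in> F_pubd"
  proof -
    obtain m where m: "finitely_additive_invariant m" "0 < m G"
      using pubd_imp_invariant_content[OF G] by blast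
    obtain N where N: "\<forall>s :: nat \<Rightarrow> nat. \<exists>i j n. i < j \<and> j \<le> N \<and> n + s i \<in> G \<and> n + s j \<in> G"
      using content_pigeonhole[OF m] ..
    obtain s :: "nat \<Rightarrow> nat" where s: "\<forall>i j. i < j \<and> j \<le> N \<longrightarrow> s i \<le> s j \<and> s j - s i \<in> D"
      using differences[of N] ..
    obtain i j n where ijn: "i < j" "j \<le> N" "n + s i \<in> G" "n + s j \<in> G"
      using N[rule_format, of s] by blast
    then have "s i \<le> s j" "s j - s i \<in> F"
      using s DF by auto
    with ijn(3,4) show ?thesis
      by (intro bexI[of _ "s j - s i"] exI[of _ "n + s i"]) simp_all
  qed
qed

text \<open>The common hitting time is generalized in stages: from the pairs (U, U), (U, V) to a
  common source with two arbitrary targets, and then to two arbitrary pairs. Boxes in the product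
  and preimages of the targets finally give arbitrarily large times.\<close>

lemma weakly_mixing_criterion:
  assumes pre: "\<And>U n. opene X U \<Longrightarrow> opene X (preimage X T n U)"
    and meet: "\<And>U V. opene X U \<Longrightarrow> opene X V \<Longrightarrow> hitting_times T U U \<inter> hitting_times T U V \<noteq> {}"
  shows "weakly_mixing X T"
proof -
  have opene_Int_pre: "opene X (U \<inter> preimage X T n V)" if "opene X U" "opene X V" "n \<in> hitting_times T U V" for U V n
  proof -
    have "U \<subseteq> mspace X"
      using that(1) openin_subset unfolding opene_def by fastforce
    then have "U \<inter> preimage X T n V \<noteq> {}"
      using that(3) by (auto simp: hitting_times_iff preimage_def)
    then show ?thesis
      using that openin_preimage by (auto simp: opene_def)
  qed
  \<comment> \<open>Passing to \<open>A \<inter> T\<^sup>-\<^sup>q B\<close> turns a return to this set into a hit of \<open>B\<close>.\<close>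
  have same: "\<exists>n. n \<in> hitting_times T A B \<and> n \<in> hitting_times T A D"
    if A: "opene X A" and B: "opene X B" and D: "opene X D" for A B D
  proof -
    obtain q where "q \<in> hitting_times T A B"
      using meet[OF A B] by blast
    then have A2: "opene X (A \<inter> preimage X T q B)"
      by (rule opene_Int_pre[OF A B])
    obtain n where n: "n \<in> hitting_times T (A \<inter> preimage X T q B) (A \<inter> preimage X T q B)"
      "n \<in> hitting_times T (A \<inter> preimage X T q B) (preimage X T q D)"
      using meet[OF A2 pre[OF D]] by blast
    then have "q + n \<in> hitting_times T A B" "q + n \<in> hitting_times T A D"
      by (auto simp: hitting_times_iff preimage_def funpow_add)
    then show ?thesis by blast
  qed
  \<comment> \<open>The source A \<inter> T^-p C and the target T^-p D carry the second pair: the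
    image under T^p of a point hitting T^-p D starts in C and hits D at the same time, since
    iterates commute.\<close>
  have pair: "\<exists>n. n \<in> hitting_times T A B \<and> n \<in> hitting_times T C D"
    if A: "opene X A" and B: "opene X B" and C: "opene X C" and D: "opene X D" for A B C D
  proof -
    obtain p where p: "p \<in> hitting_times T A C"
      using meet[OF A C] by blast
    then obtain n where n: "n \<in> hitting_times T (A \<inter> preimage X T p C) B"
      "n \<in> hitting_times T (A \<inter> preimage X T p C) (preimage X T p D)"
      using same[OF opene_Int_pre[OF A C p] B pre[OF D]] by blast
    obtain u where u: "(T ^^ p) u \<in> C" "(T ^^ p) ((T ^^ n) u) \<in> D"
      using n(2) by (auto simp: hitting_times_iff preimage_def)
    then have "n \<in> hitting_times T C D"
      unfolding hitting_times_iff funpow_commute[of p T n] by blast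
    moreover have "n \<in> hitting_times T A B"
      using n(1) by (auto simp: hitting_times_iff)
    ultimately show ?thesis by blast
  qed
  show ?thesis
    unfolding weakly_mixing_def transitive_def infinite_nat_iff_unbounded_le
  proof (intro allI impI)
    fix W Z k assume W: "opene (prod_metric X X) W" and Z: "opene (prod_metric X X) Z"
    obtain A C where AC: "opene X A" "opene X C" "A \<times> C \<subseteq> W"
      using W by (rule opene_prod_box)
    obtain B D where BD: "opene X B" "opene X D" "B \<times> D \<subseteq> Z"
      using Z by (rule opene_prod_box)
    \<comment> \<open>Aiming at the \<open>k\<close>-th preimages of the targets makes the actual
      hitting time \<open>k + n\<close>, hence at least \<open>k\<close>.\<close>
    obtain n u v where n: "u \<in> A" "(T ^^ n) u \<in> preimage X T k B" "v \<in> C" "(T ^^ n) v \<in> preimage X T k D"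
      using pair[OF AC(1) pre[OF BD(1)] AC(2) pre[OF BD(2)]] unfolding hitting_times_iff by blast
    then have "(u, v) \<in> W" "(map_prod T T ^^ (k + n)) (u, v) \<in> Z"
      using AC(3) BD(3) by (auto simp: preimage_def funpow_map_prod funpow_add)
    then have "k + n \<in> hitting_times (map_prod T T) W Z"
      unfolding hitting_times_iff by blast
    then show "\<exists>n\<ge>k. n \<in> hitting_times (map_prod T T) W Z"
      by (meson le_add1)
  qed
qed

lemma weakly_mixing_hitting:
  assumes "weakly_mixing X T" "opene X A" "opene X B" "opene X C" "opene X D"
  shows "\<exists>n\<ge>k. n \<in> hitting_times T A B \<and> n \<in> hitting_times T C D"
proof -
  have "opene (prod_metric X X) (A \<times> C)" "opene (prod_metric X X) (B \<times> D)"
    using assms by (auto simp: opene_def openin_prod_Times_iff)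
  then obtain n where "n \<ge> k" "n \<in> hitting_times (map_prod T T) (A \<times> C) (B \<times> D)"
    using assms(1) unfolding weakly_mixing_def transitive_def infinite_nat_iff_unbounded_le by blast
  then show ?thesis
    by (auto simp: hitting_times_iff funpow_map_prod)
qed

lemma weakly_mixing_imp_transitive: "weakly_mixing X T \<Longrightarrow> transitive X T"
  unfolding transitive_def infinite_nat_iff_unbounded_le using weakly_mixing_hitting by blast

end

text \<open>The witnesses for \<open>F_D\<close> live on sets of reals, so the properties of D-sets
  are instantiated at that type, independently of the system under study.\<close>

lemma F_D_subset_F_pubd: "F \<in> F_D \<Longrightarrow> F \<in> F_pubd"
  unfolding F_D_def using D_set_from_properties(1) D_set_from_def by blast

lemma F_D_difference:
  assumes "F \<in> F_D" "G \<in> F_pubd"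
  obtains k n where "k \<in> F" "n \<in> G" "n + k \<in> G"
  using assms D_set_from_properties(2) D_set_from_def unfolding F_D_def by blast

context
  fixes X :: "'a metric" and T :: "'a \<Rightarrow> 'a"
  assumes TDS: "TDS X T"
begin

lemma F_D_transitive_point_imp_weakly_mixing:
  assumes x: "x \<in> Trans F_D X T"
  shows "weakly_mixing X T"
proof (rule weakly_mixing_criterion[OF TDS])
  have xX: "x \<in> mspace X" and visit: "\<And>U. opene X U \<Longrightarrow> visit_times T x U \<in> F_D"
    using x by (auto simp: Trans_def)
  show pre: "opene X (preimage X T n U)" if U: "opene X U" for U n
  proof -
    \<comment> \<open>A visit at a time \<open>k\<close> at least \<open>n\<close> is needed: T^(k -
      n) x then witnesses that the \<open>n\<close>-th preimage is nonempty.\<close>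
    obtain k where "k \<in> visit_times T x U" "n \<le> k"
      using F_pubd_unbounded[OF F_D_subset_F_pubd[OF visit[OF U]]] by blast
    then have "(T ^^ n) ((T ^^ (k - n)) x) \<in> U"
      by (simp add: visit_times_def flip: comp_apply[of "T ^^ n"] funpow_add)
    then have "(T ^^ (k - n)) x \<in> preimage X T n U"
      using xX by (simp add: preimage_def funpow_in_mspace[OF TDS])
    then show ?thesis
      using U openin_preimage[OF TDS] by (auto simp: opene_def)
  qed
  fix U V assume U: "opene X U" and V: "opene X V"
  have pubd: "visit_times T x U \<in> F_pubd"
    using F_D_subset_F_pubd visit U by blast
  then obtain t where t: "(T ^^ t) x \<in> U"
    using F_pubd_nonempty by (auto simp: visit_times_def)
  \<comment> \<open>One \<open>k\<close> serves both hitting sets, through two different points of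
    \<open>U\<close>: T^n x returns to \<open>U\<close>, and T^t x moves into
    \<open>V\<close>.\<close>
  obtain k n where kn: "(T ^^ k) x \<in> preimage X T t V" "(T ^^ n) x \<in> U" "(T ^^ (n + k)) x \<in> U"
    using F_D_difference[OF visit[OF pre[OF V]] pubd] unfolding visit_times_def by blast
  have "(T ^^ k) ((T ^^ n) x) \<in> U"
    using kn(3) by (simp add: funpow_add add.commute[of n])
  moreover have "(T ^^ k) ((T ^^ t) x) = (T ^^ t) ((T ^^ k) x)"
    by (rule funpow_commute)
  then have "(T ^^ k) ((T ^^ t) x) \<in> V"
    using kn(1) by (simp add: preimage_def)
  ultimately have "k \<in> hitting_times T U U" "k \<in> hitting_times T U V"
    using kn(2) t unfolding hitting_times_iff by blast+
  then show "hitting_times T U U \<inter> hitting_times T U V \<noteq> {}"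
    by blast
qed

end

section \<open>Invariant measures and dense orbits\<close>

text \<open>The sets are balls around finite nets of shrinking mesh. Their closures must fit into U
  because \<open>inner_content\<close> only sees closed subsets of U; a radius below r/2 around a
  net point close to u achieves this.\<close>

lemma compact_metric_pi_base:
  fixes X :: "'a metric"
  assumes "compact_space (mtopology_of X)" "mspace X \<noteq> {}"
  shows "\<exists>B :: nat \<Rightarrow> 'a set. (\<forall>i. opene X (B i)) \<and>
    (\<forall>U. opene X U \<longrightarrow> (\<exists>i. mtopology_of X closure_of B i \<subseteq> U))"
proof -
  interpret X: Metric_space "mspace X" "mdist X" by simp
  have top: "mtopology_of X = X.mtopology"
    by (simp add: mtopology_of_def)
  have "X.mtotally_bounded (mspace X)"
    using assms(1) X.compactin_imp_mtotally_bounded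
    by (metis compact_space_def mtopology_of_def topspace_mtopology_of)
  then have "\<exists>K. finite K \<and> K \<subseteq> mspace X \<and> mspace X \<subseteq> (\<Union>x\<in>K. X.mball x (inverse (Suc n)))" for n
    unfolding X.mtotally_bounded_def by simp
  then obtain K where K: "\<And>n. finite (K n)" "\<And>n. K n \<subseteq> mspace X"
      "\<And>n. mspace X \<subseteq> (\<Union>x\<in>K n. X.mball x (inverse (Suc n)))"
    by metis
  define \<B> where "\<B> = (\<lambda>(n, c). X.mball c (inverse (Suc n))) ` (SIGMA n:UNIV. K n)"
  have "countable \<B>"
    unfolding \<B>_def by (intro countable_image countable_SIGMA) (auto simp: K countable_finite)
  have "K 0 \<noteq> {}"
    using K(3)[of 0] assms(2) by auto
  then have "\<B> \<noteq> {}"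
    by (auto simp: \<B>_def)
  have opn: "opene X V" if V: "V \<in> \<B>" for V
  proof -
    obtain n c where "c \<in> K n" "V = X.mball c (inverse (Suc n))"
      using V by (auto simp: \<B>_def simp del: of_nat_Suc)
    moreover have "c \<in> X.mball c (inverse (Suc n))"
      using K(2)[of n] \<open>c \<in> K n\<close> by (intro X.centre_in_mball_iff[THEN iffD2]) auto
    ultimately show ?thesis
      unfolding opene_def top using X.openin_mball by blast
  qed
  have small: "\<exists>V\<in>\<B>. mtopology_of X closure_of V \<subseteq> U" if U: "opene X U" for U
  proof -
    obtain u where u: "u \<in> U"
      using U by (auto simp: opene_def)
    have uX: "u \<in> mspace X"
      using U u openin_subset unfolding opene_def by fastforce
    obtain r where r: "0 < r" "X.mball u r \<subseteq> U"
      using U u unfolding opene_def top X.openin_mtopology by blast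
    then obtain n where n: "inverse (real (Suc n)) < r / 2"
      using reals_Archimedean[of "r / 2"] by auto
    obtain c where c: "c \<in> K n" "u \<in> X.mball c (inverse (Suc n))"
      using K(3)[of n] uX by auto
    have "X.mtopology closure_of X.mball c (inverse (Suc n)) \<subseteq> X.mcball c (inverse (Suc n))"
      by (intro closure_of_minimal X.closedin_mcball X.mball_subset_mcball)
    also have "\<dots> \<subseteq> X.mball u r"
    proof
      fix v assume "v \<in> X.mcball c (inverse (Suc n))"
      then have v: "v \<in> mspace X" "c \<in> mspace X" "mdist X c v \<le> inverse (Suc n)"
        by auto
      have "mdist X c u < inverse (Suc n)"
        using c(2) by auto
      moreover have "mdist X u v \<le> mdist X c u + mdist X c v"
        using X.triangle[of u c v] uX v X.commute[of u c] by linarith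
      ultimately have "mdist X u v < r"
        using n v(3) by linarith
      then show "v \<in> X.mball u r"
        using uX v by simp
    qed
    finally have "X.mtopology closure_of X.mball c (inverse (Suc n)) \<subseteq> U"
      using r(2) by blast
    moreover have "X.mball c (inverse (Suc n)) \<in> \<B>"
      unfolding \<B>_def using c(1) by (intro image_eqI[of _ _ "(n, c)"]) auto
    ultimately show ?thesis
      unfolding top by blast
  qed
  have rng: "range (from_nat_into \<B>) = \<B>"
    by (rule range_from_nat_into) fact+
  show ?thesis
  proof (intro exI[of _ "from_nat_into \<B>"] conjI allI impI)
    show "opene X (from_nat_into \<B> i)" for i
      by (rule opn[OF from_nat_into]) fact
    show "\<exists>i. mtopology_of X closure_of from_nat_into \<B> i \<subseteq> U" if U: "opene X U" for U
    proof -
      obtain V where "V \<in> range (from_nat_into \<B>)" "mtopology_of X closure_of V \<subseteq> U"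
        using small[OF U] unfolding rng by blast
      then show ?thesis by blast
    qed
  qed
qed

text \<open>Full support needs one content that is positive on countably many sets. The series of
  the individual contents with weights 2^-(i+1) is again an invariant probability, and each set
  keeps its own positive summand.\<close>

lemma invariant_content_combination:
  fixes F :: "nat \<Rightarrow> nat set"
  assumes "\<And>i. F i \<in> F_pubd"
  shows "\<exists>m. finitely_additive_invariant m \<and> (\<forall>i. 0 < m (F i))"
proof -
  have "\<forall>i. \<exists>m. finitely_additive_invariant m \<and> 0 < m (F i)"
    using pubd_imp_invariant_content[OF assms] by blast
  then obtain M where M: "\<And>i. finitely_additive_invariant (M i)" "\<And>i. 0 < M i (F i)"
    by metis
  define m where "m A = (\<Sum>i. (1/2) ^ Suc i * M i A)" for A
  have half: "summable (\<lambda>i. (1/2 :: real) ^ Suc i)" "(\<Sum>i. (1/2 :: real) ^ Suc i) = 1"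
    using power_half_series by (auto simp: sums_iff)
  have bound: "0 \<le> M i A" "M i A \<le> 1" for i A
    using content_nonneg[OF M(1)] content_mono[OF M(1), of A UNIV i] content_UNIV[OF M(1)] by auto
  have summ: "summable (\<lambda>i. (1/2) ^ Suc i * M i A)" for A
  proof (rule summable_comparison_test'[OF half(1)])
    show "norm ((1/2) ^ Suc i * M i A) \<le> (1/2) ^ Suc i" for i
      using bound[of i A] by (simp add: abs_mult mult_left_le)
  qed
  have "finitely_additive_invariant m"
    unfolding finitely_additive_invariant_def
  proof (intro conjI allI impI)
    show "0 \<le> m A" for A
      unfolding m_def using bound by (intro suminf_nonneg summ) auto
    show "m UNIV = 1"
      unfolding m_def using half(2) content_UNIV[OF M(1)] by simp
    show "m (A \<union> B) = m A + m B" if "A \<inter> B = {}" for A B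
      unfolding m_def suminf_add[OF summ summ] content_Un[OF M(1) that] distrib_left ..
    show "m (Suc -` A) = m A" for A
      unfolding m_def content_Suc[OF M(1)] ..
  qed
  moreover have "0 < m (F i)" for i
    unfolding m_def
  proof (rule suminf_pos2[OF summ])
    show "0 \<le> (1/2) ^ Suc n * M n (F i)" for n
      using bound by auto
    show "0 < (1/2) ^ Suc i * M i (F i)"
      using M(2) by simp
  qed
  ultimately show ?thesis by blast
qed

text \<open>The visit times of \<open>x\<close> to T^-1 A are those to A shifted by one, so shift
  invariance of \<open>m\<close> becomes \<open>T\<close>-invariance of \<open>\<nu>\<close>. It is
  carried over to the inner content of open sets and from there to all Borel sets.\<close>

lemma pubd_transitive_point_imp_E_system:
  fixes X :: "'a metric" and T :: "'a \<Rightarrow> 'a"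
  assumes TDS: "TDS X T" and trans: "transitive X T" and x: "x \<in> mspace X"
    and visit: "\<And>U. opene X U \<Longrightarrow> visit_times T x U \<in> F_pubd"
  shows "E_system X T"
proof -
  let ?X = "mtopology_of X"
  have X: "mspace X \<noteq> {}" "compact_space ?X" and contT: "continuous_map ?X ?X T"
    using TDS by (auto simp: TDS_def)
  interpret X: Metric_space "mspace X" "mdist X" by simp
  have normal: "normal_space ?X" and Hausdorff: "Hausdorff_space ?X"
    using X.normal_space_mtopology X.Hausdorff_space_mtopology by (simp_all add: mtopology_of_def)
  obtain B where B: "\<forall>i :: nat. opene X (B i)" "\<forall>U. opene X U \<longrightarrow> (\<exists>i. ?X closure_of B i \<subseteq> U)"
    using compact_metric_pi_base[OF X(2,1)] by (elim exE conjE)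
  note B = B[rule_format]
  obtain m where m: "finitely_additive_invariant m" "\<And>i. 0 < m (visit_times T x (B i))"
    using invariant_content_combination[of "\<lambda>i. visit_times T x (B i)"] visit[OF B(1)] by blast
  define \<nu> where "\<nu> A = ennreal (m (visit_times T x A))" for A
  interpret \<nu>: finitely_additive_content ?X \<nu>
  proof
    show "compact_space ?X" "normal_space ?X"
      by fact+
    have "visit_times T x {} = {}"
      by (simp add: visit_times_def)
    then show "\<nu> {} = 0"
      by (simp add: \<nu>_def content_empty[OF m(1)])
    show "\<nu> (A \<union> A') = \<nu> A + \<nu> A'" if "A \<inter> A' = {}" for A A'
    proof -
      have "visit_times T x (A \<union> A') = visit_times T x A \<union> visit_times T x A'"
        "visit_times T x A \<inter> visit_times T x A' = {}"
        using that by (auto simp: visit_times_def)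
      then show ?thesis
        by (simp add: \<nu>_def content_Un[OF m(1)] content_nonneg[OF m(1)])
    qed
  qed
  have \<nu>_T: "\<nu> (T -` A \<inter> mspace X) = \<nu> A" for A
  proof -
    have "visit_times T x (T -` A \<inter> mspace X) = Suc -` visit_times T x A"
      using funpow_in_mspace[OF TDS x] by (auto simp: visit_times_def)
    then show ?thesis
      by (simp add: \<nu>_def content_Suc[OF m(1)])
  qed
  obtain \<mu> where \<mu>: "space \<mu> = mspace X" "sets \<mu> = sigma_sets (mspace X) {U. openin ?X U}"
      "\<forall>U. openin ?X U \<longrightarrow> emeasure \<mu> U = \<nu>.inner_content U"
    using \<nu>.measure_extending_inner_content unfolding topspace_mtopology_of by (elim exE conjE)
  note \<mu> = \<mu>(1,2) \<mu>(3)[rule_format]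
  have openT: "openin ?X (T -` U \<inter> mspace X)" if "openin ?X U" for U
    using openin_continuous_map_preimage[OF contT that] by (simp add: vimage_def Int_def conj_commute)
  have closedT: "closedin ?X (T -` K \<inter> mspace X)" if "closedin ?X K" for K
    using closedin_continuous_map_preimage[OF contT that] by (simp add: vimage_def Int_def conj_commute)
  \<comment> \<open>Closed sets are transported both ways: T K is closed as a compact set in a
    Hausdorff space, and T^-1 K is closed by continuity.\<close>
  have inner_T: "\<nu>.inner_content (T -` U \<inter> mspace X) = \<nu>.inner_content U" for U
  proof (rule antisym)
    show "\<nu>.inner_content (T -` U \<inter> mspace X) \<le> \<nu>.inner_content U"
      unfolding \<nu>.inner_content_def[of "T -` U \<inter> mspace X"]
    proof (rule SUP_least)
      fix K assume "K \<in> {K. closedin ?X K \<and> K \<subseteq> T -` U \<inter> mspace X}"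
      then have K: "closedin ?X K" "K \<subseteq> T -` U \<inter> mspace X" by auto
      have "compactin ?X (T ` K)"
        using closedin_compact_space[OF X(2) K(1)] contT by (rule image_compactin)
      then have "closedin ?X (T ` K)"
        by (rule compactin_imp_closedin[OF Hausdorff])
      have "\<nu> K \<le> \<nu> (T -` (T ` K) \<inter> mspace X)"
        using K(2) by (intro \<nu>.mono) auto
      also have "\<dots> = \<nu> (T ` K)"
        by (rule \<nu>_T)
      also have "\<dots> \<le> \<nu>.inner_content U"
        using K(2) by (intro \<nu>.inner_content_upper \<open>closedin ?X (T ` K)\<close>) auto
      finally show "\<nu> K \<le> \<nu>.inner_content U" .
    qed
    show "\<nu>.inner_content U \<le> \<nu>.inner_content (T -` U \<inter> mspace X)"
      unfolding \<nu>.inner_content_def[of U]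
    proof (rule SUP_least)
      fix K assume "K \<in> {K. closedin ?X K \<and> K \<subseteq> U}"
      then have K: "closedin ?X K" "K \<subseteq> U" by auto
      have "\<nu> (T -` K \<inter> mspace X) \<le> \<nu>.inner_content (T -` U \<inter> mspace X)"
        using K closedT by (intro \<nu>.inner_content_upper) auto
      then show "\<nu> K \<le> \<nu>.inner_content (T -` U \<inter> mspace X)"
        by (simp add: \<nu>_T)
    qed
  qed
  have visit_space: "visit_times T x (mspace X) = UNIV"
    using funpow_in_mspace[OF TDS x] by (auto simp: visit_times_def)
  have "\<nu> A \<le> 1" for A
    using content_mono[OF m(1), of "visit_times T x A" UNIV] content_UNIV[OF m(1)] by (simp add: \<nu>_def)
  then have "\<nu>.inner_content (mspace X) \<le> 1"
    unfolding \<nu>.inner_content_def by (intro SUP_least) auto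
  moreover have "\<nu> (mspace X) \<le> \<nu>.inner_content (mspace X)"
    using closedin_topspace[of ?X] by (intro \<nu>.inner_content_upper) auto
  moreover have "\<nu> (mspace X) = 1"
    by (simp add: \<nu>_def visit_space content_UNIV[OF m(1)])
  ultimately have "emeasure \<mu> (mspace X) = 1"
    using \<mu>(3)[of "mspace X"] openin_topspace[of ?X] by simp
  then have prob: "prob_space \<mu>"
    by (intro prob_spaceI) (simp add: \<mu>(1))
  have sub: "{U. openin ?X U} \<subseteq> Pow (mspace X)"
    using openin_subset[of ?X] by auto
  have open_sets: "openin ?X U \<Longrightarrow> U \<in> sets \<mu>" for U
    by (simp add: \<mu>(2) sigma_sets.Basic)
  have T_meas: "T \<in> measurable \<mu> \<mu>"
  proof (rule measurable_sigma_sets[OF \<mu>(2) sub])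
    show "T \<in> space \<mu> \<rightarrow> mspace X"
      using contT by (auto simp: \<mu>(1) continuous_map_def)
    show "T -` U \<inter> space \<mu> \<in> sets \<mu>" if "U \<in> {U. openin ?X U}" for U
      using that openT open_sets by (simp add: \<mu>(1))
  qed
  \<comment> \<open>Both measures are finite and agree on the open sets, which are stable under
    intersection and generate the Borel sets.\<close>
  have "\<mu> = distr \<mu> \<mu> T"
  proof (rule measure_eqI_generator_eq[OF _ sub _ \<mu>(2)])
    show "Int_stable {U. openin ?X U}"
      by (auto simp: Int_stable_def)
    show "emeasure \<mu> U = emeasure (distr \<mu> \<mu> T) U" if "U \<in> {U. openin ?X U}" for U
      using that openT open_sets by (simp add: emeasure_distr[OF T_meas] \<mu>(1,3) inner_T)
    show "range (\<lambda>i::nat. mspace X) \<subseteq> {U. openin ?X U}"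
      using openin_topspace[of ?X] by auto
    show "emeasure \<mu> (mspace X) \<noteq> \<infinity>"
      using \<open>emeasure \<mu> (mspace X) = 1\<close> by simp
  qed (simp_all add: \<mu>(2))
  then have "invariant_under T \<mu>"
    unfolding invariant_under_def by (metis emeasure_distr T_meas)
  moreover have "measure_support X \<mu> = mspace X"
  proof -
    have "0 < emeasure \<mu> U" if U: "opene X U" for U
    proof -
      \<comment> \<open>The closure of \<open>B i\<close> is a closed subset of \<open>U\<close>, so
        the positive value of \<open>\<nu>\<close> on \<open>B i\<close> survives in the inner
        content of \<open>U\<close>.\<close>
      obtain i where i: "?X closure_of B i \<subseteq> U"
        using B(2)[OF U] ..
      have "B i \<subseteq> ?X closure_of B i"
        using B(1)[of i] by (intro closure_of_subset openin_subset) (simp add: opene_def)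
      then have "\<nu> (B i) \<le> \<nu> (?X closure_of B i)"
        by (rule \<nu>.mono)
      also have "\<dots> \<le> \<nu>.inner_content U"
        using i by (intro \<nu>.inner_content_upper) auto
      finally have "\<nu> (B i) \<le> \<nu>.inner_content U" .
      moreover have "0 < \<nu> (B i)"
        using m(2)[of i] by (simp add: \<nu>_def)
      ultimately show ?thesis
        using U \<mu>(3)[of U] by (simp add: opene_def)
    qed
    then show ?thesis
      by (auto simp: measure_support_def opene_def)
  qed
  ultimately show ?thesis
    unfolding E_system_def borel_prob_on_def using trans \<mu>(1,2) prob by blast
qed

text \<open>The mean number of visits to \<open>U\<close> in the first N steps is N times the
  measure of \<open>U\<close>, so some z attains at least this number. The pattern of z holds on an
  open set, which the dense orbit of \<open>y\<close> enters.\<close>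

lemma E_system_dense_orbit_pubd:
  fixes X :: "'a metric" and T :: "'a \<Rightarrow> 'a"
  assumes TDS: "TDS X T" and E: "E_system X T" and y: "y \<in> mspace X"
    and dense: "\<And>U. opene X U \<Longrightarrow> \<exists>n. (T ^^ n) y \<in> U" and U: "opene X U"
  shows "visit_times T y U \<in> F_pubd"
proof -
  let ?X = "mtopology_of X"
  obtain \<mu> where \<mu>: "borel_prob_on X \<mu>" "invariant_under T \<mu>" "measure_support X \<mu> = mspace X"
    using E unfolding E_system_def by blast
  have space: "space \<mu> = mspace X" and prob: "prob_space \<mu>"
    and sets: "sets \<mu> = sigma_sets (mspace X) {U. openin ?X U}"
    using \<mu>(1) unfolding borel_prob_on_def by auto
  interpret prob_space \<mu> by (rule prob)
  have oU: "openin ?X U" and UX: "U \<subseteq> mspace X"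
    using U openin_subset[of ?X U] by (auto simp: opene_def)
  have meas: "preimage X T n U \<in> sets \<mu>" for n
    using openin_preimage[OF TDS oU] by (simp add: sets sigma_sets.Basic)
  have inv: "emeasure \<mu> (preimage X T n U) = emeasure \<mu> U" for n
  proof (induction n)
    case 0
    have "preimage X T 0 U = U"
      using UX by (auto simp: preimage_def)
    then show ?case by simp
  next
    case (Suc n)
    have "preimage X T (Suc n) U = T -` preimage X T n U \<inter> space \<mu>"
      using funpow_in_mspace[OF TDS, of _ 1] by (auto simp: preimage_def space funpow_swap1)
    then show ?case
      using \<mu>(2) meas Suc unfolding invariant_under_def by metis
  qed
  obtain u where u: "u \<in> U"
    using U by (auto simp: opene_def)
  have "0 < emeasure \<mu> U"
    using \<mu>(3) u UX oU unfolding measure_support_def by blast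
  then have pos: "0 < prob U"
    by (simp add: emeasure_eq_measure)
  have "\<exists>k. prob U * real N \<le> real (card (visit_times T y U \<inter> {k..<k + N}))" for N
  proof -
    define f where "f z = card {i\<in>{..<N}. (T ^^ i) z \<in> U}" for z
    have f_le: "f z \<le> N" for z
      using card_mono[of "{..<N}" "{i\<in>{..<N}. (T ^^ i) z \<in> U}"] by (auto simp: f_def)
    have fin: "finite (f ` mspace X)"
      by (rule finite_subset[of _ "{..N}"]) (use f_le in auto)
    moreover have "f ` mspace X \<noteq> {}"
      using y by blast
    \<comment> \<open>The number of visits takes finitely many values; a maximizer dominates the
      mean.\<close>
    ultimately obtain z where z: "z \<in> mspace X" "f z = Max (f ` mspace X)"
      using Max_in by (metis imageE)
    have f_max: "f w \<le> f z" if "w \<in> mspace X" for w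
      unfolding z(2) using fin that by (intro Max_ge) auto
    let ?g = "\<lambda>w. \<Sum>i<N. indicat_real (preimage X T i U) w"
    have "expectation ?g = (\<Sum>i<N. prob (preimage X T i U))"
      using meas by (subst Bochner_Integration.integral_sum) (auto simp: emeasure_eq_measure)
    also have "\<dots> = prob U * real N"
      using inv by (simp add: measure_def)
    finally have "expectation ?g = prob U * real N" .
    moreover have "expectation ?g \<le> real (f z)"
    proof (rule integral_le_const)
      show "integrable \<mu> ?g"
        using meas by (intro Bochner_Integration.integrable_sum) (auto simp: emeasure_eq_measure)
      have "?g w \<le> real (f z)" if w: "w \<in> mspace X" for w
      proof -
        have "?g w = (\<Sum>i<N. of_bool ((T ^^ i) w \<in> U))"
          using w by (intro sum.cong) (auto simp: preimage_def indicator_def)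
        also have "\<dots> = real (f w)"
          by (simp add: f_def Collect_conj_eq lessThan_def)
        finally show ?thesis
          using f_max[OF w] by simp
      qed
      then show "AE w in \<mu>. ?g w \<le> real (f z)"
        by (intro AE_I2) (simp add: space)
    qed
    ultimately have fz: "prob U * real N \<le> real (f z)" by simp
    define J where "J = {i\<in>{..<N}. (T ^^ i) z \<in> U}"
    have "openin ?X {w \<in> mspace X. \<forall>j\<in>J. (T ^^ j) w \<in> U}"
      by (rule openin_preimages[OF TDS _ oU]) (simp add: J_def)
    moreover have "z \<in> {w \<in> mspace X. \<forall>j\<in>J. (T ^^ j) w \<in> U}"
      using z by (simp add: J_def)
    ultimately have "opene X {w \<in> mspace X. \<forall>j\<in>J. (T ^^ j) w \<in> U}"
      unfolding opene_def by blast
    then obtain k where k: "\<And>j. j \<in> J \<Longrightarrow> (T ^^ j) ((T ^^ k) y) \<in> U"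
      using dense by blast
    have "(\<lambda>j. j + k) ` J \<subseteq> visit_times T y U \<inter> {k..<k + N}"
      using k by (auto simp: J_def visit_times_def funpow_add)
    then have "card ((\<lambda>j. j + k) ` J) \<le> card (visit_times T y U \<inter> {k..<k + N})"
      by (intro card_mono) auto
    moreover have "card ((\<lambda>j. j + k) ` J) = f z"
      unfolding f_def J_def[symmetric] by (simp add: card_image inj_on_def)
    ultimately have "prob U * real N \<le> real (card (visit_times T y U \<inter> {k..<k + N}))"
      using fz by linarith
    then show ?thesis ..
  qed
  then have "\<exists>a n. N \<le> n \<and> 0 < n \<and> prob U * real n \<le> real (card (visit_times T y U \<inter> {a..<a + n}))" for N
    by (metis Suc_n_not_le_n nat_le_linear zero_less_Suc)
  with pos show ?thesis
    unfolding F_pubd_iff by blast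
qed

section \<open>Baire category and generic pairs of points\<close>

lemma compact_metric_Baire:
  fixes X :: "'a metric"
  assumes "compact_space (mtopology_of X)" "countable \<G>" "\<G> \<noteq> {}"
    and opn: "\<And>G. G \<in> \<G> \<Longrightarrow> openin (mtopology_of X) G"
    and dense: "\<And>G U. G \<in> \<G> \<Longrightarrow> opene X U \<Longrightarrow> G \<inter> U \<noteq> {}"
  shows "residual_in X (\<Inter>\<G>)"
proof -
  interpret X: Metric_space "mspace X" "mdist X" by simp
  have "locally_compact_space (mtopology_of X) \<and> regular_space (mtopology_of X)"
    using assms(1) X.regular_space_mtopology
    by (simp add: compact_imp_locally_compact_space mtopology_of_def)
  moreover have "mtopology_of X closure_of G = topspace (mtopology_of X)" if "G \<in> \<G>" for G
    unfolding dense_intersects_open using dense[OF that] by (auto simp: opene_def)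
  ultimately have "mtopology_of X closure_of \<Inter>\<G> = topspace (mtopology_of X)"
    using assms(2) opn by (intro Baire_category) auto
  moreover have "gdelta_in (mtopology_of X) (\<Inter>\<G>)"
    using assms(2,3) opn by (intro gdelta_in_Inter open_imp_gdelta_in)
  ultimately show ?thesis
    unfolding residual_in_def by auto
qed

lemma residual_in_nonempty:
  assumes "mspace X \<noteq> {}" "residual_in X R"
  shows "R \<noteq> {}"
  using assms by (auto simp: residual_in_def)

lemma residual_in_mono: "residual_in X R \<Longrightarrow> R \<subseteq> R' \<Longrightarrow> residual_in X R'"
  unfolding residual_in_def by blast

text \<open>The system itself witnesses the D-set. The recurrent point must lie in \<open>U\<close>,
  so an iterate b = T^t y in \<open>U\<close> is used; visits of (x, b) to \<open>U\<close> \<times>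
  \<open>U\<close> are in particular visits of \<open>x\<close> to \<open>U\<close>.\<close>

lemma dense_pair_imp_F_D_transitive:
  fixes X :: "'a metric" and T :: "'a \<Rightarrow> 'a"
  assumes TDS: "TDS X T" and x: "x \<in> mspace X" and y: "y \<in> mspace X"
    and dense: "\<And>U V. opene X U \<Longrightarrow> opene X V \<Longrightarrow> \<exists>k. (T ^^ k) x \<in> U \<and> (T ^^ k) y \<in> V"
    and pubd: "\<And>U. opene X U \<Longrightarrow> visit_times T y U \<in> F_pubd"
  shows "x \<in> Trans F_D X T"
  unfolding Trans_def
proof (intro CollectI conjI allI impI x)
  fix U assume U: "opene X U"
  obtain t where t: "(T ^^ t) y \<in> U"
    using dense[OF U U] by blast
  define b where "b = (T ^^ t) y"
  have bX: "b \<in> mspace X"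
    unfolding b_def using y by (rule funpow_in_mspace[OF TDS])
  have pre: "opene X (preimage X T t V)" if "openin (mtopology_of X) V" "b \<in> V" for V
  proof -
    have "y \<in> preimage X T t V"
      using that(2) y by (simp add: preimage_def b_def)
    then show ?thesis
      unfolding opene_def using openin_preimage[OF TDS that(1)] by blast
  qed
  have "recurrent_point F_pubd X T b"
    unfolding recurrent_point_def
  proof (intro conjI allI impI bX)
    fix W assume "neighborhood X b W"
    then obtain V where V: "openin (mtopology_of X) V" "b \<in> V" "V \<subseteq> W"
      unfolding neighborhood_def by blast
    have "visit_times T y (preimage X T t V) \<subseteq> visit_times T b W"
      using V(3) by (auto simp: visit_times_def preimage_def b_def funpow_commute[of _ T t])
    then show "visit_times T b W \<in> F_pubd"
      by (rule F_pubd_mono[OF pubd[OF pre[OF V(1,2)]]])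
  qed
  moreover have "neighborhood X b U"
    using U t openin_subset[of "mtopology_of X" U] unfolding neighborhood_def opene_def b_def by auto
  moreover have "(b, b) \<in> mtopology_of (prod_metric X X) closure_of orb (map_prod T T) (x, b)"
    unfolding in_closure_of
  proof (intro conjI allI impI)
    show "(b, b) \<in> topspace (mtopology_of (prod_metric X X))"
      using bX by simp
    fix W assume W: "(b, b) \<in> W \<and> openin (mtopology_of (prod_metric X X)) W"
    then have "\<exists>A B. openin (mtopology_of X) A \<and> openin (mtopology_of X) B \<and> b \<in> A \<and> b \<in> B \<and> A \<times> B \<subseteq> W"
      unfolding mtopology_of_prod_metric openin_prod_topology_alt by blast
    then obtain A B where AB: "openin (mtopology_of X) A" "openin (mtopology_of X) B" "b \<in> A" "b \<in> B"
      "A \<times> B \<subseteq> W" by blast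
    have "opene X A"
      using AB by (auto simp: opene_def)
    \<comment> \<open>Pulling \<open>B\<close> back by T^t turns a condition on the orbit of b into
      one on the orbit of \<open>y\<close>, to which the density of the orbit of (x, y)
      applies.\<close>
    then obtain k where "(T ^^ k) x \<in> A" "(T ^^ k) y \<in> preimage X T t B"
      using dense[OF _ pre[OF AB(2,4)]] by blast
    then have "((T ^^ k) x, (T ^^ k) b) \<in> W"
      using AB(5) by (auto simp: preimage_def b_def funpow_commute[of k T t])
    then show "\<exists>p. p \<in> orb (map_prod T T) (x, b) \<and> p \<in> W"
      unfolding orb_def by (metis funpow_map_prod rangeI)
  qed
  moreover have "visit_times (map_prod T T) (x, b) (U \<times> U) \<subseteq> visit_times T x U"
    by (auto simp: visit_times_def funpow_map_prod)
  ultimately have "D_set_from X T (visit_times T x U)"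
    unfolding D_set_from_def using TDS x by blast
  then show "visit_times T x U \<in> F_D"
    by (rule D_set_from_imp_F_D)
qed

text \<open>Baire category is used twice: first for one good \<open>y\<close>, then, with
  \<open>y\<close> fixed, for the points \<open>x\<close> whose pair with \<open>y\<close> has a
  dense orbit.\<close>

lemma weakly_mixing_E_system_imp_residual:
  fixes X :: "'a metric" and T :: "'a \<Rightarrow> 'a"
  assumes TDS: "TDS X T" and wm: "weakly_mixing X T" and E: "E_system X T"
  shows "residual_in X (Trans F_D X T)"
proof -
  let ?X = "mtopology_of X"
  have X: "mspace X \<noteq> {}" "compact_space ?X"
    using TDS by (auto simp: TDS_def)
  obtain B where "\<forall>i :: nat. opene X (B i)" "\<forall>U. opene X U \<longrightarrow> (\<exists>i. ?X closure_of B i \<subseteq> U)"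
    using compact_metric_pi_base[OF X(2,1)] by (elim exE conjE)
  note B = this(1)[rule_format] and B_sub = this(2)[rule_format]
  have base: "\<exists>i. B i \<subseteq> U" if U: "opene X U" for U
  proof -
    obtain i where "?X closure_of B i \<subseteq> U"
      using B_sub[OF U] ..
    moreover have "B i \<subseteq> ?X closure_of B i"
      using B[of i] by (intro closure_of_subset openin_subset) (simp add: opene_def)
    ultimately show ?thesis by blast
  qed
  have opn: "openin ?X (\<Union>k\<in>K. preimage X T k (B j))" for j K
    using openin_preimage[OF TDS] B by (auto simp: opene_def)
  \<comment> \<open>Membership of \<open>y\<close> in all these sets says that each set of visit
    times of \<open>y\<close> to \<open>B j\<close> meets each hitting set of \<open>B n\<close> and
    \<open>B i\<close>. Weak mixing makes them dense.\<close>
  define W where "W = (\<lambda>(i, j, n). \<Union>k\<in>hitting_times T (B n) (B i). preimage X T k (B j))"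
  have "residual_in X (\<Inter>(range W))"
  proof (rule compact_metric_Baire[OF X(2)])
    show "openin ?X G" if "G \<in> range W" for G
      using that opn by (auto simp: W_def)
    show "G \<inter> U \<noteq> {}" if G: "G \<in> range W" and U: "opene X U" for G U
    proof -
      obtain i j n where G: "G = (\<Union>k\<in>hitting_times T (B n) (B i). preimage X T k (B j))"
        using G by (auto simp: W_def)
      obtain k where k: "k \<in> hitting_times T U (B j)" "k \<in> hitting_times T (B n) (B i)"
        using weakly_mixing_hitting[OF TDS wm U B B B] by blast
      obtain u where u: "u \<in> U" "(T ^^ k) u \<in> B j"
        using k(1) unfolding hitting_times_iff by blast
      have "u \<in> mspace X"
        using u U openin_subset[of ?X U] by (auto simp: opene_def)
      with u k(2) show ?thesis
        unfolding G preimage_def by blast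
    qed
  qed auto
  then obtain y where "y \<in> \<Inter>(range W)"
    using residual_in_nonempty[OF X(1)] by blast
  then have y_W: "y \<in> W (i, j, n)" for i j n
    by blast
  have hit: "\<exists>k. k \<in> hitting_times T (B n) (B i) \<and> (T ^^ k) y \<in> B j" and y: "y \<in> mspace X" for i j n
    using y_W[of i j n] by (auto simp: W_def preimage_def)
  have "\<exists>n. (T ^^ n) y \<in> U" if "opene X U" for U
    using base[OF that] hit by blast
  then have pubd: "visit_times T y U \<in> F_pubd" if "opene X U" for U
    using E_system_dense_orbit_pubd[OF TDS E y _ that] by blast
  \<comment> \<open>The intersection consists of the \<open>x\<close> such that (x, y) enters every
    \<open>B i\<close> \<times> \<open>B j\<close>. Density is exactly what the choice of
    \<open>y\<close> provides: a point of \<open>B n\<close> reaches \<open>B i\<close> at a time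
    when \<open>y\<close> visits \<open>B j\<close>.\<close>
  define P where "P = (\<lambda>(i, j). \<Union>k\<in>{k. (T ^^ k) y \<in> B j}. preimage X T k (B i))"
  have "residual_in X (\<Inter>(range P))"
  proof (rule compact_metric_Baire[OF X(2)])
    show "openin ?X G" if "G \<in> range P" for G
      using that opn by (auto simp: P_def)
    show "G \<inter> U \<noteq> {}" if G: "G \<in> range P" and U: "opene X U" for G U
    proof -
      obtain i j where G: "G = (\<Union>k\<in>{k. (T ^^ k) y \<in> B j}. preimage X T k (B i))"
        using G by (auto simp: P_def)
      obtain n where n: "B n \<subseteq> U"
        using base[OF U] ..
      obtain k u where k: "u \<in> B n" "(T ^^ k) u \<in> B i" "(T ^^ k) y \<in> B j"
        using hit[of n i j] unfolding hitting_times_iff by blast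
      have "u \<in> mspace X"
        using k(1) n U openin_subset[of ?X U] by (auto simp: opene_def)
      with k n show ?thesis
        unfolding G preimage_def by blast
    qed
  qed auto
  moreover have "\<Inter>(range P) \<subseteq> Trans F_D X T"
  proof
    fix x assume "x \<in> \<Inter>(range P)"
    then have "x \<in> P (i, j)" for i j
      by blast
    then have x_P: "\<exists>k. (T ^^ k) x \<in> B i \<and> (T ^^ k) y \<in> B j" and x: "x \<in> mspace X" for i j
      by (fastforce simp: P_def preimage_def)+
    have "\<exists>k. (T ^^ k) x \<in> U \<and> (T ^^ k) y \<in> V" if UV: "opene X U" "opene X V" for U V
    proof -
      obtain i j where "B i \<subseteq> U" "B j \<subseteq> V"
        using base[OF UV(1)] base[OF UV(2)] by blast
      then show ?thesis
        using x_P[of i j] by blast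
    qed
    then show "x \<in> Trans F_D X T"
      by (rule dense_pair_imp_F_D_transitive[OF TDS x y _ pubd])
  qed
  ultimately show ?thesis
    by (rule residual_in_mono)
qed

theorem theorem3p9:
  fixes X :: "'a metric" and T :: "'a \<Rightarrow> 'a"
  assumes "TDS X T"
  shows "(weakly_mixing X T \<and> E_system X T \<longleftrightarrow> residual_in X (Trans F_D X T)) \<and>
         (residual_in X (Trans F_D X T) \<longleftrightarrow> point_transitive F_D X T)"
proof -
  have "point_transitive F_D X T" if "residual_in X (Trans F_D X T)"
    using residual_in_nonempty[OF _ that] assms by (simp add: TDS_def point_transitive_def)
  moreover have "weakly_mixing X T \<and> E_system X T" if pt: "point_transitive F_D X T"
  proof -
    obtain x where x: "x \<in> Trans F_D X T"
      using pt by (auto simp: point_transitive_def)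
    then have wm: "weakly_mixing X T"
      by (rule F_D_transitive_point_imp_weakly_mixing[OF assms])
    moreover have "E_system X T"
      using x F_D_subset_F_pubd unfolding Trans_def
      by (intro pubd_transitive_point_imp_E_system[OF assms weakly_mixing_imp_transitive[OF assms wm]]) auto
    ultimately show ?thesis ..
  qed
  ultimately show ?thesis
    using weakly_mixing_E_system_imp_residual[OF assms] by blast
qed

end
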